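(* Let $\chi(\hbar)=\sum_{n\ge0}(2n-1)!!\,\hbar^n$, and let $Z$ and $W=\hbar\log Z$ be the partition function and free energy of zero-dimensional Yukawa theory. Then $$Z(\hbar,j,\eta)=\frac{e^{\frac{j^2}{2\hbar}}}{1-j-\frac{|\eta|^2}{\hbar}}\,\chi\!\left(\frac{\hbar}{\left(1-j-\frac{|\eta|^2}{\hbar}\right)^2}\right)+\mathcal{O}(|\eta|^4),$$ and, coefficientwise in $j$ and up to the indicated order in $|\eta|^2$, the factorial asymptotic expansions with $A=\frac12$ are $$\mathcal{A}^{\frac12}_\hbar Z(\hbar,j,\eta)=\frac{1}{\sqrt{2\pi\hbar}}e^{\frac j\hbar}\left(1+|\eta|^2\frac{1-j}{\hbar^2}\right)+\mathcal{O}(|\eta|^4),$$ $$\mathcal{A}^{\frac12}_\hbar W(\hbar,j,\eta)=\frac{\hbar}{\sqrt{2\pi\hbar}}\,e^{\frac1\hbar\left(j-\frac{j^2}{2}\right)}\,\frac{1-j-\frac{|\eta|^2}{\hbar}\left(1-\frac{(1-j)^2}{\hbar}\right)}{\chi\left(\frac{\hbar}{\left(1-j-\frac{|\eta|^2}{\hbar}\right)^2}\right)}+\mathcal{O}(|\eta|^4).$$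
   Context: The partition function is the formal perturbative expansion of $Z(\hbar,j,\eta)=\int\frac{dx}{\sqrt{2\pi\hbar}}e^{\frac1\hbar\left(-\frac{x^2}{2}+jx+\frac{|\eta|^2}{1-x}+\hbar\log\frac1{1-x}\right)}$, with $|\eta|^2=\eta\bar\eta$: write $e^{\log\frac{1}{1-x}}=\frac1{1-x}$, expand everything except $e^{-x^2/(2\hbar)}$ in powers of $j,|\eta|^2,x$ and integrate termwise by $\int\frac{dx}{\sqrt{2\pi\hbar}}e^{-x^2/(2\hbar)}x^{2n}=\hbar^n(2n-1)!!$ (odd moments vanish; $(-1)!!=1$). Asymptotic operator: a power (or Laurent, with finitely many negative powers) series $f(\hbar)=\sum_nf_n\hbar^n$ has a factorial asymptotic expansion with parameter $A>0$ if there are $\beta\in\mathbb{R}$, $c_k\in\mathbb{R}$ with $f_n=\sum_{k=0}^{R-1}c_kA^{-n-\beta+k}\Gamma(n+\beta-k)+\mathcal{O}(A^{-n}\Gamma(n+\beta-R))$ as $n\to\infty$ for all $R\ge0$; then $(\mathcal{A}^A_\hbar f)(\hbar):=\hbar^{-\beta}\sum_kc_k\hbar^k$. It acts on each coefficient of a series in the other variables. *)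

theory Defs
  imports "HOL-Analysis.Analysis" "HOL-Computational_Algebra.Computational_Algebra"
    "HOL-Library.Landau_Symbols"
begin

section \<open>Formal series in \<open>|\<eta>|\<^sup>2\<close>, \<open>j\<close> and \<open>\<hbar>\<close>\<close>

text \<open>
  \<open>F $ b $ a\<close> is the coefficient of \<open>|\<eta>|\<^sup>2\<^sup>b j\<^sup>a\<close>, a Laurent series in \<open>\<hbar>\<close> with finitely many
  negative powers. Everything here depends on \<open>\<eta>\<close> only through the formal variable \<open>|\<eta>|\<^sup>2\<close>.
\<close>
type_synonym yseries = "real fls fps fps"

definition coef :: "real fls \<Rightarrow> yseries" where
  "coef f = fps_const (fps_const f)"

definition hbar :: yseries where "hbar = coef fls_X"
definition inv_hbar :: yseries where "inv_hbar = coef fls_X_inv"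
definition src :: yseries where "src = fps_const fps_X"
definition eta_sq :: yseries where "eta_sq = fps_X"

text \<open>
  \<open>F(u) = \<Sum>\<^sub>n F\<^sub>n u\<^sup>n\<close>, summed separately in each coefficient of \<open>|\<eta>|\<^sup>2\<^sup>b j\<^sup>a\<close> with respect to the
  \<open>\<hbar>\<close>-adic topology of formal Laurent series. All substitutions below converge: each constant
  coefficient \<open>u $ 0 $ 0\<close> is a power series in \<open>\<hbar>\<close> without constant term.
\<close>
definition subst :: "real fps \<Rightarrow> yseries \<Rightarrow> yseries" where
  "subst F u = Abs_fps (\<lambda>b. Abs_fps (\<lambda>a. \<Sum>n. fls_const (F $ n) * (u ^ n) $ b $ a))"

definition yexp :: "yseries \<Rightarrow> yseries" where
  "yexp u = subst (fps_exp 1) u"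

text \<open>The Mercator series \<open>log f = \<Sum>\<^sub>n\<^sub>\<ge>\<^sub>1 (-1)\<^sup>n\<^sup>-\<^sup>1 (f - 1)\<^sup>n / n\<close>.\<close>
definition ylog :: "yseries \<Rightarrow> yseries" where
  "ylog f = subst (fps_ln 1) (f - 1)"

text \<open>Equality up to \<open>O(|\<eta>|\<^sup>4)\<close>.\<close>
definition eq_mod_eta4 :: "yseries \<Rightarrow> yseries \<Rightarrow> bool" where
  "eq_mod_eta4 F G \<longleftrightarrow> (\<forall>b<2. F $ b = G $ b)"


section \<open>Partition function and free energy\<close>

text \<open>\<open>(2n-1)!!\<close>, with \<open>(-1)!! = 1\<close>.\<close>
definition odd_dfact :: "nat \<Rightarrow> nat" where
  "odd_dfact n = (\<Prod>i=1..n. 2 * i - 1)"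

definition chi :: "real fps" where
  "chi = Abs_fps (\<lambda>n. real (odd_dfact n))"

text \<open>\<open>\<integral> dx / \<surd>(2\<pi>\<hbar>) e\<^bsup>-x\<^sup>2/(2\<hbar>)\<^esup> x\<^sup>m\<close>\<close>
definition gauss_moment :: "nat \<Rightarrow> real fls" where
  "gauss_moment m =
     (if even m then fls_const (real (odd_dfact (m div 2))) * fls_X ^ (m div 2) else 0)"

definition gauss_int :: "real fls fps \<Rightarrow> real fls" where
  "gauss_int P = (\<Sum>m. P $ m * gauss_moment m)"

text \<open>
  The coefficient of \<open>|\<eta>|\<^sup>2\<^sup>b j\<^sup>a\<close> in
  \<open>exp (j x / \<hbar>) exp (|\<eta>|\<^sup>2 / (\<hbar> (1 - x))) / (1 - x)\<close>, as a power series in \<open>x\<close> (here \<open>fps_X\<close>).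
\<close>
definition yukawa_integrand :: "nat \<Rightarrow> nat \<Rightarrow> real fls fps" where
  "yukawa_integrand b a =
     fps_const (fls_const (1 / fact a)) * (fps_const fls_X_inv * fps_X) ^ a *
     (fps_const (fls_const (1 / fact b)) * (fps_const fls_X_inv * inverse (1 - fps_X)) ^ b) *
     inverse (1 - fps_X)"

definition yukawa_Z :: yseries where
  "yukawa_Z = Abs_fps (\<lambda>b. Abs_fps (\<lambda>a. gauss_int (yukawa_integrand b a)))"

definition yukawa_W :: yseries where
  "yukawa_W = hbar * ylog yukawa_Z"


section \<open>Factorial asymptotic expansions\<close>

definition has_factorial_expansion :: "real \<Rightarrow> real fls \<Rightarrow> real \<Rightarrow> (nat \<Rightarrow> real) \<Rightarrow> bool" where
  "has_factorial_expansion A f \<beta> c \<longleftrightarrow> A > 0 \<and>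
     (\<forall>R::nat. (\<lambda>n::nat. fls_nth f (int n) -
          (\<Sum>k<R. c k * A powr (- real n - \<beta> + real k) * Gamma (real n + \<beta> - real k)))
        \<in> O(\<lambda>n. A powr (- real n) * Gamma (real n + \<beta> - real R)))"

definition factorially_expandable :: "real \<Rightarrow> real fls \<Rightarrow> bool" where
  "factorially_expandable A f \<longleftrightarrow> (\<exists>\<beta> c. has_factorial_expansion A f \<beta> c)"

text \<open>
  A formal series in real powers of \<open>\<hbar>\<close> is the function mapping an exponent to its coefficient;
  \<open>hbar_powr s F\<close> is the series \<open>\<hbar>\<^sup>s F(\<hbar>)\<close>.
\<close>
definition hbar_powr :: "real \<Rightarrow> real fls \<Rightarrow> (real \<Rightarrow> real)" where
  "hbar_powr s F = (\<lambda>e. if e - s \<in> \<int> then fls_nth F \<lfloor>e - s\<rfloor> else 0)"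

text \<open>
  The pair \<open>(\<beta>, c)\<close> is not unique (shift \<open>\<beta>\<close> by an integer and relabel \<open>c\<close>), but the series
  \<open>\<hbar>\<^sup>-\<^sup>\<beta> \<Sum>\<^sub>k c\<^sub>k \<hbar>\<^sup>k\<close> is: two distinct ones would differ in a lowest term, which dominates the errors.
\<close>
definition asymp_op :: "real \<Rightarrow> real fls \<Rightarrow> (real \<Rightarrow> real)" where
  "asymp_op A f =
     (THE g. \<exists>\<beta> c. has_factorial_expansion A f \<beta> c \<and>
                   g = hbar_powr (- \<beta>) (fps_to_fls (Abs_fps c)))"

text \<open>
  \<open>\<A>\<^sup>A F = \<hbar>\<^sup>s G + O(|\<eta>|\<^sup>4)\<close>, the operator acting on each coefficient of \<open>|\<eta>|\<^sup>2\<^sup>b j\<^sup>a\<close>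
  (and every coefficient concerned having an expansion).
\<close>
definition asymp_eq_mod_eta4 :: "real \<Rightarrow> yseries \<Rightarrow> real \<Rightarrow> yseries \<Rightarrow> bool" where
  "asymp_eq_mod_eta4 A F s G \<longleftrightarrow>
     (\<forall>b<2. \<forall>a. factorially_expandable A (F $ b $ a) \<and>
                asymp_op A (F $ b $ a) = hbar_powr s (G $ b $ a))"

end

theory Submission
  imports Defs
begin

unbundle fps_syntax and no vec_syntax

text \<open>
  Shifting the integration variable by \<open>j\<close> amounts to the equation \<open>(1 - \<hbar> \<partial>\<^sub>j) Z = e\<^bsup>j\<^sup>2/(2\<hbar>)\<^esup>\<close> at order 0 in
  \<open>|\<eta>|\<^sup>2\<close>, which determines \<open>Z\<close> from \<open>Z(\<hbar>, 0) = \<chi>\<close> and which the closed form satisfies because of the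
  differential equation \<open>\<chi> = 1 + \<hbar> \<chi> + 2 \<hbar>\<^sup>2 \<chi>'\<close>. Order 1 follows by integration by parts.

  The coefficients of \<open>Z\<close> are explicit double factorials, so their expansions can be read off. For \<open>W\<close>, the
  order 0 part of \<open>log Z\<close> satisfies the equation \<open>(1 - j) \<partial>\<^sub>j F = 1 + j/\<hbar> + 2 \<theta> F\<close> with \<open>\<theta> = \<hbar> \<partial>\<^sub>\<hbar>\<close>, the order 1
  part of \<open>W\<close> is \<open>\<partial>\<^sub>j log Z - j/\<hbar>\<close>, and \<open>\<A>\<close> turns \<open>\<theta>\<close> into \<open>\<theta> + 1/(2\<hbar>)\<close>. Hence everything reduces to the
  expansion at \<open>j = 0\<close>, that is to \<open>log \<chi>\<close>. By the differential equation its coefficients are those of \<open>1/\<chi>\<close>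
  divided by \<open>-2n\<close>, and \<open>\<chi> (1/\<chi>) = 1\<close> gives \<open>\<A> (1/\<chi>) = - \<A> \<chi> / \<chi>\<^sup>2\<close>, since in a convolution of double
  factorials only the two ends contribute.
\<close>

section \<open>Substitution into formal series\<close>

text \<open>The hypothesis makes the coefficients up to any index stable from some term on, and it
  also bounds the orders of all terms from below by one integer. The finite coefficientwise sums
  therefore form a Laurent series, and the partial sums converge to it in the metric on
  \<open>fls\<close>, to which \<open>suminf\<close> refers.\<close>

lemma fls_suminf_nth:
  fixes f :: "nat \<Rightarrow> real fls"
  assumes "\<And>k. \<exists>B. \<forall>n\<ge>B. \<forall>l\<le>k. f n $$ l = 0"
  shows "(\<And>n. n \<ge> B \<Longrightarrow> f n $$ k = 0) \<Longrightarrow> suminf f $$ k = (\<Sum>n<B. f n $$ k)"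
proof -
  obtain b where b: "\<And>k n l. n \<ge> b k \<Longrightarrow> l \<le> k \<Longrightarrow> f n $$ l = 0"
    using assms by metis
  define c where "c k = (\<Sum>n<b k. f n $$ k)" for k
  \<comment> \<open>Terms before \<open>b 0\<close> contribute their own orders; later terms have no
    coefficient at an index up to 0. The inserted 0 keeps \<open>m\<close> nonpositive, so that it
    bounds these as well.\<close>
  define m where "m = Min (insert 0 ((\<lambda>n. fls_subdegree (f n)) ` {..<b 0}))"
  have m: "f n $$ k = 0" if "k < m" for n k
  proof (cases "n < b 0")
    case True
    then have "m \<le> fls_subdegree (f n)" unfolding m_def by (intro Min_le) auto
    then show ?thesis using that by simp
  next
    case False
    moreover have "m \<le> 0" unfolding m_def by (intro Min_le) auto
    ultimately show ?thesis using that by (intro b[of 0]) auto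
  qed
  define S where "S = Abs_fls c"
  have S: "S $$ k = c k" for k
    unfolding S_def by (rule nth_Abs_fls_lower_bound[of m]) (auto simp: c_def m)
  have c: "c k = (\<Sum>n<B. f n $$ k)" if "\<And>n. n \<ge> B \<Longrightarrow> f n $$ k = 0" for k B
  proof -
    have "c k = (\<Sum>n<max B (b k). f n $$ k)"
      unfolding c_def by (rule sum.mono_neutral_left) (auto intro: b)
    also have "\<dots> = (\<Sum>n<B. f n $$ k)"
      by (rule sum.mono_neutral_right) (auto intro: that)
    finally show ?thesis .
  qed
  have "f sums S"
    unfolding sums_def
  proof (rule metric_LIMSEQ_I)
    fix r :: real assume "r > 0"
    then obtain k where "(1 / 2) ^ k < r"
      using real_arch_pow_inv[of r "1 / 2"] by auto
    then have k: "inverse (2 ^ k) < r"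
      by (simp add: power_one_over inverse_eq_divide)
    \<comment> \<open>A difference of subdegree \<open>d \<ge> 0\<close> has size
      \<open>inverse (2 ^ d)\<close>, so agreement of all coefficients up to index \<open>k\<close>
      suffices.\<close>
    have "dist (sum f {..<n}) S < r" if n: "n \<ge> b (int k)" for n
    proof (cases "sum f {..<n} = S")
      case False
      let ?D = "sum f {..<n} - S"
      have "?D $$ l = 0" if "l \<le> int k" for l
      proof -
        have "c l = (\<Sum>i<n. f i $$ l)"
          using n that b by (intro c) (meson le_trans)
        then show ?thesis by (simp add: S fls_nth_sum)
      qed
      moreover have "?D $$ fls_subdegree ?D \<noteq> 0"
        using False by (intro nth_fls_subdegree_nonzero) simp
      ultimately have "fls_subdegree ?D > int k" by (meson not_le)
      then have "fls_subdegree ?D \<ge> 0" "nat (fls_subdegree ?D) \<ge> k" by auto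
      then have "dist (sum f {..<n}) S \<le> inverse (2 ^ k)"
        using False by (simp add: dist_fls_def le_imp_inverse_le)
      then show ?thesis using k by simp
    qed (use \<open>r > 0\<close> in simp)
    then show "\<exists>no. \<forall>n\<ge>no. dist (sum f {..<n}) S < r" by blast
  qed
  then show "(\<And>n. n \<ge> B \<Longrightarrow> f n $$ k = 0) \<Longrightarrow> suminf f $$ k = (\<Sum>n<B. f n $$ k)"
    using S c by (auto simp: sums_iff)
qed

lemma fls_times_nth_eq_0:
  fixes f g :: "real fls"
  assumes "\<And>k. k < p \<Longrightarrow> f $$ k = 0" "\<And>k. k < q \<Longrightarrow> g $$ k = 0" "k < p + q"
  shows "(f * g) $$ k = 0"
proof (cases "f = 0 \<or> g = 0")
  case False
  then have "p \<le> fls_subdegree f" "q \<le> fls_subdegree g"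
    using assms(1,2) by (auto intro!: fls_subdegree_geI)
  then show ?thesis using assms(3) by (intro fls_times_nth_eq0) auto
qed auto

text \<open>
  The filtration in which all substitutions converge: \<open>j\<close> has weight \<open>-2\<close> and \<open>\<hbar>\<close> weight \<open>1\<close>, so that
  \<open>j / \<hbar>\<close> and \<open>j\<^sup>2 / \<hbar>\<close> have positive weight.
\<close>
definition hval :: "int \<Rightarrow> real fls fps \<Rightarrow> bool" where
  "hval d F \<longleftrightarrow> (\<forall>i k. k < d - 2 * int i \<longrightarrow> F $ i $$ k = 0)"

lemma hvalD: "hval d F \<Longrightarrow> k < d - 2 * int i \<Longrightarrow> F $ i $$ k = 0"
  by (simp add: hval_def)

lemma hval_mono: "hval d F \<Longrightarrow> e \<le> d \<Longrightarrow> hval e F"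
  by (simp add: hval_def)

lemma hval_0 [simp]: "hval d 0"
  by (simp add: hval_def)

lemma hval_add: "hval d F \<Longrightarrow> hval d G \<Longrightarrow> hval d (F + G)"
  by (simp add: hval_def)

lemma hval_diff: "hval d F \<Longrightarrow> hval d G \<Longrightarrow> hval d (F - G)"
  by (simp add: hval_def)

lemma hval_mult:
  assumes "hval d F" "hval e G"
  shows "hval (d + e) (F * G)"
  unfolding hval_def
proof (intro allI impI)
  fix i k assume k: "k < d + e - 2 * int i"
  have "(F $ l * G $ (i - l)) $$ k = 0" if "l \<le> i" for l
    using k that
    by (intro fls_times_nth_eq_0[of "d - 2 * int l" _ "e - 2 * int (i - l)"])
      (auto intro: hvalD[OF assms(1)] hvalD[OF assms(2)])
  then show "(F * G) $ i $$ k = 0"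
    by (simp add: fps_mult_nth fls_nth_sum)
qed

lemma hval_const [simp]: "hval 0 (fps_const (fls_const c))"
  by (simp add: hval_def)

lemma hval_const_mult: "hval d F \<Longrightarrow> hval d (fps_const (fls_const c) * F)"
  using hval_mult[OF hval_const] by fastforce

lemma hval_1 [simp]: "hval 0 1"
  using hval_const[of 1] by simp

lemma hval_power: "hval 1 v \<Longrightarrow> hval (int n) (v ^ n)"
  by (induction n) (auto dest: hval_mult)

lemma hval_eqI: assumes "\<And>d. hval (int d) (F - G)" shows "F = G"
proof (intro fps_ext fls_eqI)
  fix i k
  have "(F - G) $ i $$ k = 0"
    by (rule hvalD[OF assms[of "nat (k + 2 * int i + 1)"]]) simp
  then show "F $ i $$ k = G $ i $$ k" by simp
qed

text \<open>Below the stated weight only the first \<open>B\<close> terms contribute, so an infinite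
  sum may be replaced by a truncation. The offset \<open>c\<close> leaves room for a fixed factor of
  negative weight, as it occurs at order 1 in |\<eta>|^2.\<close>

lemma hval_suminf:
  assumes P: "\<And>n. hval (int n - c) (P n)"
  shows "hval (int B - c) (Abs_fps (\<lambda>a. \<Sum>n. P n $ a) - (\<Sum>n<B. P n))"
  unfolding hval_def
proof (intro allI impI)
  fix i k assume k: "k < int B - c - 2 * int i"
  have z: "P n $ i $$ l = 0" if "l < int n - c - 2 * int i" for n l
    using P that by (rule hvalD)
  have "(\<Sum>n. P n $ i) $$ k = (\<Sum>n<B. P n $ i $$ k)"
  proof (rule fls_suminf_nth)
    fix k show "\<exists>B. \<forall>n\<ge>B. \<forall>l\<le>k. P n $ i $$ l = 0"
      by (rule exI[of _ "nat (k + c + 2 * int i + 1)"]) (auto intro!: z)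
  qed (use k in \<open>auto intro!: z\<close>)
  then show "(Abs_fps (\<lambda>a. \<Sum>n. P n $ a) - (\<Sum>n<B. P n)) $ i $$ k = 0"
    by (simp add: fps_sum_nth fls_nth_sum)
qed

text \<open>This is \<open>subst\<close> at order 0 in |\<eta>|^2, where only the order 0 part of
  the argument enters.\<close>

definition fsub :: "real fps \<Rightarrow> real fls fps \<Rightarrow> real fls fps" where
  "fsub F v = Abs_fps (\<lambda>a. \<Sum>n. fls_const (F $ n) * (v ^ n) $ a)"

abbreviation rconst :: "real \<Rightarrow> real fls fps" where
  "rconst c \<equiv> fps_const (fls_const c)"

lemma rconst_add: "rconst (a + b) = rconst a + rconst b"
  by (simp add: fls_eq_iff)

lemma rconst_mult: "rconst (a * b) = rconst a * rconst b"
  by simp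

lemma hval_fsub_term: "hval 1 v \<Longrightarrow> hval (int n) (rconst c * v ^ n)"
  by (intro hval_const_mult hval_power)

lemma fsub_approx:
  assumes "hval 1 v"
  shows "hval (int B) (fsub F v - (\<Sum>n<B. rconst (F $ n) * v ^ n))"
  using hval_suminf[of 0 "\<lambda>n. rconst (F $ n) * v ^ n" B] hval_fsub_term[OF assms]
  by (simp add: fsub_def)

text \<open>The filtration is separated, so a substitution is determined by its truncations, even up
  to a fixed loss of weight. The linearity and multiplication rules below thus become identities of
  finite sums.\<close>

lemma fsub_eqI:
  assumes "hval 1 v" and "\<And>B. hval (int B - c) (X - (\<Sum>n<B. rconst (F $ n) * v ^ n))"
  shows "X = fsub F v"
proof (rule hval_eqI)
  fix d
  define B where "B = d + nat c"
  have "hval (int d) (X - (\<Sum>n<B. rconst (F $ n) * v ^ n))"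
    by (rule hval_mono[OF assms(2)]) (simp add: B_def)
  moreover have "hval (int d) (fsub F v - (\<Sum>n<B. rconst (F $ n) * v ^ n))"
    by (rule hval_mono[OF fsub_approx[OF assms(1)]]) (simp add: B_def)
  ultimately show "hval (int d) (X - fsub F v)"
    using hval_diff by fastforce
qed

lemma hval_fsub: assumes "hval 1 v" shows "hval 0 (fsub F v)"
  using fsub_approx[OF assms, of 0 F] by simp

lemma fsub_nth_0:
  assumes "v $ 0 = 0"
  shows "fsub F v $ 0 = fls_const (F $ 0)"
proof -
  have "(\<lambda>n. fls_const (F $ n) * (v ^ n) $ 0) = (\<lambda>n. if n = 0 then fls_const (F $ 0) else 0)"
    using assms by (auto simp: fps_power_zeroth fun_eq_iff)
  then have "(\<Sum>n. fls_const (F $ n) * (v ^ n) $ 0) = fls_const (F $ 0)"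
    using suminf_finite[of "{0::nat}" "\<lambda>n. if n = 0 then fls_const (F $ 0) else 0"] by simp
  then show ?thesis by (simp add: fsub_def)
qed

lemma fsub_nth_0_X:
  assumes "v $ 0 = fls_X"
  shows "fsub F v $ 0 = fps_to_fls F"
proof (rule fls_eqI)
  fix k
  have z: "(fls_const (F $ n) * (v ^ n) $ 0) $$ k = (if k = int n then F $ n else 0)" for n k
    using assms by (auto simp: fps_power_zeroth)
  have "(\<Sum>n. fls_const (F $ n) * (v ^ n) $ 0) $$ k =
      (\<Sum>n<nat (k + 1). (fls_const (F $ n) * (v ^ n) $ 0) $$ k)"
  proof (rule fls_suminf_nth)
    fix k show "\<exists>B. \<forall>n\<ge>B. \<forall>l\<le>k. (fls_const (F $ n) * (v ^ n) $ 0) $$ l = 0"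
      unfolding z by (rule exI[of _ "nat (k + 1)"]) auto
  qed (unfold z, auto)
  also have "\<dots> = fps_to_fls F $$ k"
  proof (cases "k < 0")
    case False
    then have "(\<Sum>n<nat (k + 1). if k = int n then F $ n else 0) =
        (\<Sum>n<nat (k + 1). if n = nat k then F $ nat k else 0)"
      by (intro sum.cong) auto
    then show ?thesis using False unfolding z by simp
  qed (auto simp: z)
  finally show "fsub F v $ 0 $$ k = fps_to_fls F $$ k" by (simp add: fsub_def)
qed

lemma fsub_add:
  assumes v: "hval 1 v"
  shows "fsub (F + G) v = fsub F v + fsub G v"
proof (rule fsub_eqI[OF v, symmetric, of 0])
  fix B
  have eq: "fsub F v + fsub G v - (\<Sum>n<B. rconst ((F + G) $ n) * v ^ n) =
      (fsub F v - (\<Sum>n<B. rconst (F $ n) * v ^ n)) + (fsub G v - (\<Sum>n<B. rconst (G $ n) * v ^ n))"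
    unfolding fps_add_nth rconst_add distrib_right sum.distrib by algebra
  show "hval (int B - 0) (fsub F v + fsub G v - (\<Sum>n<B. rconst ((F + G) $ n) * v ^ n))"
    unfolding eq using hval_add[OF fsub_approx[OF v] fsub_approx[OF v]] by (simp only: diff_0_right)
qed

lemma fsub_X_mult:
  assumes v: "hval 1 v"
  shows "fsub (fps_X * F) v = v * fsub F v"
proof (rule fsub_eqI[OF v, symmetric, of 0])
  fix B
  show "hval (int B - 0) (v * fsub F v - (\<Sum>n<B. rconst ((fps_X * F) $ n) * v ^ n))"
  proof (cases B)
    case 0
    then show ?thesis using hval_mono[OF hval_mult[OF v hval_fsub[OF v, of F]], of 0] by simp
  next
    case (Suc b)
    have "v * fsub F v - (\<Sum>n<B. rconst ((fps_X * F) $ n) * v ^ n) =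
        v * (fsub F v - (\<Sum>n<b. rconst (F $ n) * v ^ n))"
      by (simp add: Suc sum.lessThan_Suc_shift algebra_simps sum_distrib_left del: sum.lessThan_Suc)
    then show ?thesis using hval_mult[OF v fsub_approx[OF v, of b F]] Suc by simp
  qed
qed

lemma fsub_const:
  assumes v: "hval 1 v"
  shows "fsub (fps_const c) v = rconst c"
proof (rule fsub_eqI[OF v, symmetric, of 0])
  fix B
  have "(\<Sum>n<B. rconst (fps_const c $ n) * v ^ n) = (if B = 0 then 0 else rconst c)"
    by (cases B) (auto simp: sum.lessThan_Suc_shift simp del: sum.lessThan_Suc)
  then show "hval (int B - 0) (rconst c - (\<Sum>n<B. rconst (fps_const c $ n) * v ^ n))"
    by simp
qed

lemma fsub_const_mult:
  assumes v: "hval 1 v"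
  shows "fsub (fps_const c * F) v = rconst c * fsub F v"
proof (rule fsub_eqI[OF v, symmetric, of 0])
  fix B
  have "rconst c * fsub F v - (\<Sum>n<B. rconst ((fps_const c * F) $ n) * v ^ n) =
      rconst c * (fsub F v - (\<Sum>n<B. rconst (F $ n) * v ^ n))"
    by (simp only: fps_mult_left_const_nth rconst_mult right_diff_distrib sum_distrib_left mult.assoc)
  then show "hval (int B - 0) (rconst c * fsub F v - (\<Sum>n<B. rconst ((fps_const c * F) $ n) * v ^ n))"
    by (simp add: hval_const_mult fsub_approx v)
qed

text \<open>For the derivative of the logarithm. Weight 1 removes the \<hbar>^0 coefficient of
  \<open>v $ 0\<close>, so \<open>1 + v\<close> is a unit and its inverse is characterised by the
  product.\<close>

lemma fsub_geometric:
  assumes v: "hval 1 v"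
  shows "fsub (inverse (1 + fps_X)) v = inverse (1 + v)"
proof -
  have *: "fsub (inverse (1 + fps_X)) v + v * fsub (inverse (1 + fps_X)) v = 1"
  proof -
    have "fsub (inverse (1 + fps_X) + fps_X * inverse (1 + fps_X)) v = fsub (fps_const 1) v"
      by (rule arg_cong[of _ _ "\<lambda>F. fsub F v"])
        (metis distrib_right mult_1 fps_const_1_eq_1 inverse_mult_eq_1' fps_add_nth fps_one_nth
          fps_X_nth add.right_neutral zero_neq_one)
    then show ?thesis by (simp only: fsub_add[OF v] fsub_X_mult[OF v] fsub_const[OF v]) simp
  qed
  have "v $ 0 $$ 0 = 0" using v by (simp add: hval_def)
  then have "(1 + v) $ 0 $$ 0 \<noteq> (0 :: real fls) $$ 0" by simp
  then have "(1 + v) $ 0 \<noteq> 0" by metis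
  then show ?thesis using * by (intro fps_inverse_unique[symmetric]) (auto simp: algebra_simps)
qed

text \<open>The instances are \<open>\<partial>/\<partial>j\<close> and \<open>\<hbar> \<partial>/\<partial>\<hbar>\<close>.\<close>
definition hderivation :: "(real fls fps \<Rightarrow> real fls fps) \<Rightarrow> bool" where
  "hderivation D \<longleftrightarrow> (\<forall>F G. D (F + G) = D F + D G) \<and> (\<forall>F G. D (F * G) = F * D G + D F * G) \<and>
     (\<forall>c. D (rconst c) = 0) \<and> (\<forall>d F. hval d F \<longrightarrow> hval (d - 2) (D F))"

text \<open>Chain rule: on truncations it is the power rule, and both remainders have high
  weight.\<close>

lemma hderivation_fsub:
  assumes D: "hderivation D" and v: "hval 1 v"
  shows "D (fsub F v) = fsub (fps_deriv F) v * D v"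
proof (rule hval_eqI)
  fix d :: nat
  have add: "D (F + G) = D F + D G" and mult: "D (F * G) = F * D G + D F * G"
    and const: "D (rconst c) = 0" and val: "hval d F \<Longrightarrow> hval (d - 2) (D F)" for F G c d
    using D unfolding hderivation_def by blast+
  have D0: "D 0 = 0" using const[of 0] by simp
  have diff: "D (F - G) = D F - D G" for F G
    using add[of "F - G" G] by (simp add: algebra_simps)
  have sum: "D (\<Sum>n<B. P n) = (\<Sum>n<B. D (P n))" for P and B :: nat
    by (induction B) (auto simp: D0 add)
  have pow: "D (v ^ Suc n) = rconst (real (Suc n)) * v ^ n * D v" for n
  proof (induction n)
    case (Suc n)
    have "D (v ^ Suc (Suc n)) = v * D (v ^ Suc n) + D v * v ^ Suc n"
      by (subst power_Suc) (rule mult)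
    also have "\<dots> = (rconst (real (Suc n)) + 1) * v ^ Suc n * D v"
      by (simp only: Suc.IH) (simp add: algebra_simps)
    also have "rconst (real (Suc n)) + 1 = rconst (real (Suc (Suc n)))"
      using rconst_add[of "real (Suc n)" 1] by (simp add: add_ac)
    finally show ?case .
  qed simp
  \<comment> \<open>A derivation may lower the weight by 2; the additional terms make up for
    this.\<close>
  define b where "b = d + 2"
  let ?R = "fsub F v - (\<Sum>n<Suc b. rconst (F $ n) * v ^ n)"
  let ?R' = "fsub (fps_deriv F) v - (\<Sum>n<b. rconst (fps_deriv F $ n) * v ^ n)"
  have "D v * (\<Sum>n<b. rconst (fps_deriv F $ n) * v ^ n) = (\<Sum>n<b. rconst (F $ Suc n) * D (v ^ Suc n))"
    unfolding sum_distrib_left pow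
  proof (rule sum.cong)
    fix n
    have "rconst (fps_deriv F $ n) = rconst (F $ Suc n) * rconst (real (Suc n))"
      by (simp add: mult.commute del: of_nat_Suc)
    then show "D v * (rconst (fps_deriv F $ n) * v ^ n) =
        rconst (F $ Suc n) * (rconst (real (Suc n)) * v ^ n * D v)"
      by (simp only: mult_ac)
  qed simp
  also have "\<dots> = D (\<Sum>n<Suc b. rconst (F $ n) * v ^ n)"
    by (simp add: sum mult const sum.lessThan_Suc_shift add
        del: sum.lessThan_Suc power_Suc)
  finally have "D (fsub F v) - fsub (fps_deriv F) v * D v = D ?R - D v * ?R'"
    by (simp add: diff algebra_simps)
  moreover have "hval (int d) (D ?R)"
    by (rule hval_mono[OF val[OF fsub_approx[OF v]]]) (simp add: b_def)
  moreover have "hval (int d) (D v * ?R')"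
    by (rule hval_mono[OF hval_mult[OF val[OF v] fsub_approx[OF v]]]) (simp add: b_def)
  ultimately show "hval (int d) (D (fsub F v) - fsub (fps_deriv F) v * D v)"
    by (simp add: hval_diff)
qed

section \<open>Factorial asymptotic expansions\<close>

text \<open>The comparison term A^(-n-\<beta>+k) \<Gamma>(n+\<beta>-k), indexed by the exponent
  \<open>e = k - \<beta>\<close> that its coefficient has in the resulting series. In this form it
  no longer depends on the choice of \<beta>.\<close>

definition growth :: "real \<Rightarrow> real \<Rightarrow> nat \<Rightarrow> real" where
  "growth A e n = A powr (- real n + e) * Gamma (real n - e)"

text \<open>The product formula of Gauss gives \<Gamma>(n+K-e) ~ n! n^(K-1-e), so the quotient
  behaves like n^(a-b).\<close>

lemma Gamma_ratio_tendsto_0: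
  fixes a b :: real
  assumes "a < b"
  shows "(\<lambda>n. Gamma (real n - b) / Gamma (real n - a)) \<longlonglongrightarrow> 0"
proof -
  \<comment> \<open>The shift by \<open>K\<close> makes the argument \<open>K - 1 - e\<close> of the
    product formula positive for both exponents.\<close>
  define K where "K = nat \<lceil>\<bar>b\<bar> + \<bar>a\<bar>\<rceil> + 2"
  have K: "real K - 1 - e > 0" if "e = a \<or> e = b" for e
    using that unfolding K_def by linarith
  define r where "r e n = Gamma (real (n + K) - e) / (fact n * exp ((real K - 1 - e) * ln (real n)))" for e n
  have r: "r e \<longlonglongrightarrow> 1" if "e = a \<or> e = b" for e
  proof -
    define z where "z = real K - 1 - e"
    have z: "z > 0" using K[OF that] by (simp add: z_def)
    then have G: "Gamma z > 0" by simp
    have "(\<lambda>n. Gamma z / Gamma_series z n) \<longlonglongrightarrow> Gamma z / Gamma z"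
      using G by (intro tendsto_intros Gamma_series_LIMSEQ) auto
    moreover have "Gamma z / Gamma_series z n = r e n" for n
    proof -
      have "z \<notin> \<int>\<^sub>\<le>\<^sub>0" using z by (auto simp: nonpos_Ints_def)
      then have "pochhammer z (n + 1) = Gamma (z + real (n + 1)) / Gamma z"
        by (rule pochhammer_Gamma)
      moreover have e: "real (n + K) - e = z + real (n + 1)" by (simp add: z_def)
      ultimately show ?thesis
        using G unfolding Gamma_series_def r_def z_def[symmetric] e by (simp add: mult_ac)
    qed
    ultimately show ?thesis using G by simp
  qed
  have "(\<lambda>n. r b n / r a n * exp (- (b - a) * ln (real n))) \<longlonglongrightarrow> 1 / 1 * 0"
  proof (intro tendsto_mult tendsto_divide r)
    show "(\<lambda>n. exp (- (b - a) * ln (real n))) \<longlonglongrightarrow> 0"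
      using assms
      by (intro filterlim_compose[OF exp_at_bot] filterlim_tendsto_neg_mult_at_bot[OF tendsto_const]
          filterlim_compose[OF ln_at_top] filterlim_real_sequentially) simp_all
  qed auto
  moreover have "r b n / r a n * exp (- (b - a) * ln (real n)) =
      Gamma (real (n + K) - b) / Gamma (real (n + K) - a)" for n
    by (simp add: r_def field_simps exp_diff exp_minus left_diff_distrib exp_add)
  ultimately have "(\<lambda>n. Gamma (real (n + K) - b) / Gamma (real (n + K) - a)) \<longlonglongrightarrow> 0"
    by simp
  then show ?thesis by (rule LIMSEQ_offset)
qed

lemma eventually_growth_pos:
  assumes "A > 0" shows "eventually (\<lambda>n. growth A e n > 0) at_top"
proof -
  have "eventually (\<lambda>n::nat. real n > e) at_top"
    by (rule filterlim_real_sequentially[THEN filterlim_at_top_dense[THEN iffD1], rule_format])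
  then show ?thesis by eventually_elim (use assms in \<open>simp add: growth_def\<close>)
qed

lemma growth_smallo:
  assumes "A > 0" "a < b" shows "growth A b \<in> o(growth A a)"
proof (rule smalloI_tendsto)
  have "(\<lambda>n. A powr (b - a) * (Gamma (real n - b) / Gamma (real n - a))) \<longlonglongrightarrow> A powr (b - a) * 0"
    by (intro tendsto_intros Gamma_ratio_tendsto_0 assms)
  moreover have "A powr (b - a) * (Gamma (real n - b) / Gamma (real n - a)) = growth A b n / growth A a n" for n
    using assms by (simp add: growth_def powr_add powr_diff field_simps)
  ultimately show "(\<lambda>n. growth A b n / growth A a n) \<longlonglongrightarrow> 0" by simp
  show "eventually (\<lambda>n. growth A a n \<noteq> 0) at_top"
    using eventually_growth_pos[OF assms(1), of a] by eventually_elim simp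
qed

lemma hbar_powr_fps_nonzeroE:
  assumes "hbar_powr (- \<beta>) (fps_to_fls F) e \<noteq> 0"
  obtains k where "e = real k - \<beta>"
proof -
  from assms have "e + \<beta> \<in> \<int>" and nz: "fps_to_fls F $$ \<lfloor>e + \<beta>\<rfloor> \<noteq> 0"
    by (auto simp: hbar_powr_def split: if_splits)
  then obtain i where i: "e + \<beta> = of_int i" by (auto elim: Ints_cases)
  with nz have "i \<ge> 0" by (auto split: if_splits simp: not_less)
  with i have "e = real (nat i) - \<beta>" by simp
  then show ?thesis by (rule that)
qed

text \<open>An intrinsic form of the expansion, cut off at an exponent of \<hbar> instead of a
  number of terms. It mentions only the series \<open>g\<close>, so expansions with different
  \<beta> become comparable.\<close>

lemma has_factorial_expansion_cutoff:
  assumes "has_factorial_expansion A f \<beta> c"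
  defines "g \<equiv> hbar_powr (- \<beta>) (fps_to_fls (Abs_fps c))"
  shows "(\<lambda>n. f $$ int n - (\<Sum>e | e \<le> x \<and> g e \<noteq> 0. g e * growth A e n)) \<in> o(growth A x)"
proof -
  have A: "A > 0" using assms by (simp add: has_factorial_expansion_def)
  obtain R :: nat where R: "real R > x + \<beta>" using reals_Archimedean2 by blast
  define t where "t k n = c k * growth A (real k - \<beta>) n" for k n
  have "(\<lambda>n. f $$ int n - (\<Sum>k<R. t k n)) \<in> O(growth A (real R - \<beta>))"
  proof -
    have "(\<lambda>n. A powr (- real n) * Gamma (real n + \<beta> - real R)) \<in> O(growth A (real R - \<beta>))"
    proof -
      have "A powr (- real n) * Gamma (real n + \<beta> - real R) =
          A powr (\<beta> - real R) * growth A (real R - \<beta>) n" for n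
        using A by (simp add: growth_def mult.assoc[symmetric] powr_add[symmetric] algebra_simps)
      then show ?thesis by simp
    qed
    moreover have "t k n = c k * A powr (- real n - \<beta> + real k) * Gamma (real n + \<beta> - real k)" for k n
      by (simp add: t_def growth_def algebra_simps)
    ultimately show ?thesis
      using assms(1) unfolding has_factorial_expansion_def by (auto intro: landau_o.big_trans)
  qed
  also have "growth A (real R - \<beta>) \<in> o(growth A x)"
    using R by (intro growth_smallo A) simp
  finally have *: "(\<lambda>n. f $$ int n - (\<Sum>k<R. t k n)) \<in> o(growth A x)" .
  have g: "g (real k - \<beta>) = c k" for k
    by (simp add: g_def hbar_powr_def)
  have g0: "\<exists>k. e = real k - \<beta>" if "g e \<noteq> 0" for e
    using that unfolding g_def by (elim hbar_powr_fps_nonzeroE) blast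
  let ?I = "{k. k < R \<and> real k - \<beta> \<le> x \<and> c k \<noteq> 0}"
  let ?J = "{k. k < R \<and> \<not> (real k - \<beta> \<le> x \<and> c k \<noteq> 0)}"
  \<comment> \<open>Terms among the first \<open>R\<close> whose exponent exceeds \<open>x\<close>
    are themselves negligible.\<close>
  have "(\<lambda>n. \<Sum>k\<in>?J. t k n) \<in> o(growth A x)"
  proof (rule big_sum_in_smallo)
    fix k assume "k \<in> ?J"
    then consider "c k = 0" | "real k - \<beta> > x" by fastforce
    moreover have "t k = (\<lambda>n. c k * growth A (real k - \<beta>) n)" by (simp add: t_def fun_eq_iff)
    ultimately show "t k \<in> o(growth A x)"
      by cases (simp_all add: growth_smallo A)
  qed
  with * have "(\<lambda>n. (f $$ int n - (\<Sum>k<R. t k n)) + (\<Sum>k\<in>?J. t k n)) \<in> o(growth A x)"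
    by (rule sum_in_smallo)
  moreover have "(f $$ int n - (\<Sum>k<R. t k n)) + (\<Sum>k\<in>?J. t k n) =
      f $$ int n - (\<Sum>e | e \<le> x \<and> g e \<noteq> 0. g e * growth A e n)" for n
  proof -
    have "(\<Sum>k<R. t k n) = (\<Sum>k\<in>?I. t k n) + (\<Sum>k\<in>?J. t k n)"
      by (subst sum.union_disjoint[symmetric]) (auto intro!: sum.cong)
    moreover have "(\<Sum>k\<in>?I. t k n) = (\<Sum>e | e \<le> x \<and> g e \<noteq> 0. g e * growth A e n)"
    proof -
      have bij: "bij_betw (\<lambda>k. real k - \<beta>) ?I {e. e \<le> x \<and> g e \<noteq> 0}"
        unfolding bij_betw_def inj_on_def using R g g0 by (auto simp: image_iff) force
      show ?thesis
        using sum.reindex_bij_betw[OF bij, of "\<lambda>e. g e * growth A e n"] by (simp add: t_def g)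
    qed
    ultimately show ?thesis by simp
  qed
  ultimately show ?thesis by (simp only:)
qed

text \<open>At the lowest exponent \<open>x\<close> where the two series differ, subtracting their
  cutoffs at \<open>x\<close> leaves a nonzero multiple of \<open>growth A x\<close>, which would be
  negligible against itself.\<close>

lemma has_factorial_expansion_unique:
  assumes "has_factorial_expansion A f \<beta> c" "has_factorial_expansion A f \<beta>' c'"
  shows "hbar_powr (- \<beta>) (fps_to_fls (Abs_fps c)) = hbar_powr (- \<beta>') (fps_to_fls (Abs_fps c'))"
    (is "?g = ?h")
proof (rule ccontr)
  assume "?g \<noteq> ?h"
  have A: "A > 0" using assms by (simp add: has_factorial_expansion_def)
  have supp: "finite {e. e \<le> x \<and> hbar_powr (- \<beta>) (fps_to_fls (Abs_fps c)) e \<noteq> 0}" for \<beta> c x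
  proof (rule finite_subset)
    show "finite ((\<lambda>k. real k - \<beta>) ` {..nat \<lceil>x + \<beta>\<rceil>})" by simp
    show "{e. e \<le> x \<and> hbar_powr (- \<beta>) (fps_to_fls (Abs_fps c)) e \<noteq> 0} \<subseteq>
        (\<lambda>k. real k - \<beta>) ` {..nat \<lceil>x + \<beta>\<rceil>}"
    proof clarify
      fix e assume e: "e \<le> x" "hbar_powr (- \<beta>) (fps_to_fls (Abs_fps c)) e \<noteq> 0"
      then obtain k where k: "e = real k - \<beta>" by (elim hbar_powr_fps_nonzeroE)
      with e(1) have "k \<le> nat \<lceil>x + \<beta>\<rceil>" by linarith
      with k show "e \<in> (\<lambda>k. real k - \<beta>) ` {..nat \<lceil>x + \<beta>\<rceil>}" by blast
    qed
  qed
  obtain y where y: "?g y \<noteq> ?h y" using \<open>?g \<noteq> ?h\<close> by blast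
  \<comment> \<open>A lowest such exponent exists because the exponents of either series up to
    \<open>y\<close> are finitely many.\<close>
  define D where "D = {e. e \<le> y \<and> ?g e \<noteq> ?h e}"
  have "finite D"
    by (rule finite_subset[OF _ finite_UnI[OF supp[of y \<beta> c] supp[of y \<beta>' c']]]) (auto simp: D_def)
  moreover have "D \<noteq> {}" using y by (auto simp: D_def)
  ultimately obtain x where x: "x \<in> D" "\<And>e. e \<in> D \<Longrightarrow> x \<le> e"
    using Min_in Min_le by metis
  then have neq: "?g x \<noteq> ?h x" by (simp add: D_def)
  have eq: "?g e = ?h e" if "e < x" for e
    using x(1) x(2)[of e] that by (auto simp: D_def)
  have split: "(\<Sum>e | e \<le> x \<and> F e \<noteq> 0. F e * growth A e n) =
      (\<Sum>e | e < x \<and> F e \<noteq> 0. F e * growth A e n) + F x * growth A x n"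
    if "finite {e. e \<le> x \<and> F e \<noteq> 0}" for F and n
  proof (cases "F x = 0")
    case True
    then have "{e. e \<le> x \<and> F e \<noteq> 0} = {e. e < x \<and> F e \<noteq> 0}" by (auto simp: order_le_less)
    then show ?thesis using True by simp
  next
    case False
    then have *: "{e. e \<le> x \<and> F e \<noteq> 0} = insert x {e. e < x \<and> F e \<noteq> 0}" by auto
    then have "finite {e. e < x \<and> F e \<noteq> 0}" using that by simp
    then show ?thesis unfolding * by simp
  qed
  have same: "(\<Sum>e | e < x \<and> ?g e \<noteq> 0. ?g e * growth A e n) = (\<Sum>e | e < x \<and> ?h e \<noteq> 0. ?h e * growth A e n)" for n
    using eq by (intro sum.cong) auto
  have "(\<lambda>n. (f $$ int n - (\<Sum>e | e \<le> x \<and> ?g e \<noteq> 0. ?g e * growth A e n)) -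
      (f $$ int n - (\<Sum>e | e \<le> x \<and> ?h e \<noteq> 0. ?h e * growth A e n))) \<in> o(growth A x)"
    by (intro sum_in_smallo has_factorial_expansion_cutoff assms)
  also have "(\<lambda>n. (f $$ int n - (\<Sum>e | e \<le> x \<and> ?g e \<noteq> 0. ?g e * growth A e n)) -
      (f $$ int n - (\<Sum>e | e \<le> x \<and> ?h e \<noteq> 0. ?h e * growth A e n))) =
      (\<lambda>n. (?h x - ?g x) * growth A x n)"
    by (subst (1 2) split) (use supp same in \<open>auto simp: algebra_simps\<close>)
  finally have "growth A x \<in> o(growth A x)"
    using neq by simp
  moreover have "eventually (\<lambda>n. growth A x n \<noteq> 0) at_top"
    using eventually_growth_pos[OF A, of x] by eventually_elim simp
  ultimately have "eventually (\<lambda>n::nat. False) at_top"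
    unfolding landau_o.small_refl_iff by (rule eventually_elim2) simp
  then show False by simp
qed

lemma asymp_op_eqI:
  assumes "has_factorial_expansion A f \<beta> c"
  shows "asymp_op A f = hbar_powr (- \<beta>) (fps_to_fls (Abs_fps c))"
  unfolding asymp_op_def
  by (rule the_equality) (use assms has_factorial_expansion_unique in blast)+

lemma odd_dfact_0 [simp]: "odd_dfact 0 = 1"
  by (simp add: odd_dfact_def)

lemma odd_dfact_Suc [simp]: "odd_dfact (Suc n) = (2 * n + 1) * odd_dfact n"
  by (simp add: odd_dfact_def)

lemma odd_dfact_pos [simp]: "odd_dfact n > 0"
  by (induction n) auto

lemma odd_dfact_mono: "m \<le> n \<Longrightarrow> odd_dfact m \<le> odd_dfact n"
  by (induction n rule: dec_induct) (auto intro: le_trans)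

section \<open>Double factorials at integer arguments\<close>

text \<open>The continuation of (2k-1)!! to negative k through \<Gamma>(k+1/2). It is the comparison
  scale of all expansions below, and being total it can be shifted freely.\<close>

definition dfact_int :: "int \<Rightarrow> real" where
  "dfact_int k = 2 powr real_of_int k * Gamma (real_of_int k + 1 / 2) / sqrt pi"

text \<open>Half-integers are never poles of \<Gamma>, so the recursion holds at every
  integer.\<close>

lemma dfact_int_rec: "dfact_int (k + 1) = (2 * real_of_int k + 1) * dfact_int k"
proof -
  have "real_of_int k + 1 / 2 \<notin> \<int>\<^sub>\<le>\<^sub>0"
  proof
    assume "real_of_int k + 1 / 2 \<in> \<int>\<^sub>\<le>\<^sub>0"
    then obtain m where "real_of_int k + 1 / 2 = real_of_int m" by (auto elim!: nonpos_Ints_cases)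
    then have "real_of_int (2 * k + 1) = real_of_int (2 * m)" by simp
    then have "2 * k + 1 = 2 * m" by (simp only: of_int_eq_iff)
    then show False by presburger
  qed
  then have "Gamma (real_of_int k + 1 / 2 + 1) = (real_of_int k + 1 / 2) * Gamma (real_of_int k + 1 / 2)"
    by (rule Gamma_plus1)
  moreover have "real_of_int (k + 1) + 1 / 2 = real_of_int k + 1 / 2 + 1" by simp
  moreover have "2 powr real_of_int (k + 1) = 2 * 2 powr real_of_int k" by (simp add: powr_add)
  ultimately show ?thesis
    unfolding dfact_int_def by (simp only:) (simp add: algebra_simps)
qed

lemma dfact_int_of_nat: "dfact_int (int n) = real (odd_dfact n)"
proof (induction n)
  case (Suc n)
  then show ?case using dfact_int_rec[of "int n"] by (simp add: algebra_simps)
qed (simp add: dfact_int_def Gamma_one_half_real)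

lemma dfact_int_pos: "k \<ge> 0 \<Longrightarrow> dfact_int k > 0"
  using dfact_int_of_nat[of "nat k"] by simp

lemma dfact_int_mono: assumes "0 \<le> k" "k \<le> l" shows "dfact_int k \<le> dfact_int l"
  using dfact_int_of_nat[of "nat k"] dfact_int_of_nat[of "nat l"] odd_dfact_mono[of "nat k" "nat l"]
    assms by simp

lemma dfact_int_bigo_mono:
  assumes "M \<le> N" shows "(\<lambda>n. dfact_int (int n - N)) \<in> O(\<lambda>n. dfact_int (int n - M))"
proof (rule bigoI[of _ 1])
  show "\<forall>\<^sub>F n in at_top. norm (dfact_int (int n - N)) \<le> 1 * norm (dfact_int (int n - M))"
    using eventually_ge_at_top[of "nat (max N M)"]
  proof eventually_elim
    case (elim n)
    then have "0 \<le> int n - N" "0 \<le> int n - M" by auto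
    then show ?case using assms dfact_int_mono[of "int n - N" "int n - M"]
        dfact_int_pos[of "int n - N"] dfact_int_pos[of "int n - M"] by simp
  qed
qed

text \<open>By the recursion a factor n moves the scale by exactly one step; this is one direction,
  the next lemma the other.\<close>

lemma of_nat_mult_dfact_int_bigo:
  "(\<lambda>n. real n * dfact_int (int n - N)) \<in> O(\<lambda>n. dfact_int (int n - (N - 1)))"
proof (rule bigoI[of _ 1])
  show "\<forall>\<^sub>F n in at_top. norm (real n * dfact_int (int n - N)) \<le> 1 * norm (dfact_int (int n - (N - 1)))"
    using eventually_ge_at_top[of "nat (2 * \<bar>N\<bar>)"]
  proof eventually_elim
    case (elim n)
    then have *: "0 \<le> int n - N" "real n \<ge> 2 * real_of_int N" by linarith+
    have "dfact_int (int n - (N - 1)) = (2 * (real n - real_of_int N) + 1) * dfact_int (int n - N)"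
      using dfact_int_rec[of "int n - N"] by (simp add: algebra_simps)
    moreover have "real n * dfact_int (int n - N) \<le> (2 * (real n - real_of_int N) + 1) * dfact_int (int n - N)"
      using * dfact_int_pos[of "int n - N"] by (intro mult_right_mono) auto
    ultimately show ?case using * dfact_int_pos[of "int n - N"] by simp
  qed
qed

lemma dfact_int_bigo_mult_of_nat:
  "(\<lambda>n. dfact_int (int n - (N - 1))) \<in> O(\<lambda>n. real n * dfact_int (int n - N))"
proof (rule bigoI[of _ 4])
  show "\<forall>\<^sub>F n in at_top. norm (dfact_int (int n - (N - 1))) \<le> 4 * norm (real n * dfact_int (int n - N))"
    using eventually_ge_at_top[of "nat (2 * \<bar>N\<bar> + 1)"]
  proof eventually_elim
    case (elim n)
    then have *: "0 \<le> int n - N" "real n \<ge> - 2 * real_of_int N" "real n \<ge> 1" "real n \<ge> real_of_int N"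
      by linarith+
    have "dfact_int (int n - (N - 1)) = (2 * (real n - real_of_int N) + 1) * dfact_int (int n - N)"
      using dfact_int_rec[of "int n - N"] by (simp add: algebra_simps)
    moreover have "(2 * (real n - real_of_int N) + 1) * dfact_int (int n - N) \<le> (4 * real n) * dfact_int (int n - N)"
      using * dfact_int_pos[of "int n - N"] by (intro mult_right_mono) auto
    ultimately show ?case using * dfact_int_pos[of "int n - N"] by simp
  qed
qed

section \<open>Expansions in double factorials\<close>

text \<open>
  The factorial expansions with \<open>A = 1/2\<close> and \<open>\<beta> \<in> 1/2 + \<int>\<close>: if \<open>asy f G\<close>, then \<open>\<A> f\<close> is \<open>\<hbar>\<^bsup>-1/2\<^esup> G / \<surd>(2\<pi>)\<close>.
\<close>
definition asy_error :: "real fls \<Rightarrow> real fls \<Rightarrow> int \<Rightarrow> int \<Rightarrow> nat \<Rightarrow> real" where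
  "asy_error f G m N n = f $$ int n - (\<Sum>k\<in>{m..<N}. G $$ k * dfact_int (int n - k))"

definition asy :: "real fls \<Rightarrow> real fls \<Rightarrow> bool" where
  "asy f G \<longleftrightarrow> (\<forall>N. asy_error f G (fls_subdegree G) N \<in> O(\<lambda>n. dfact_int (int n - N)))"

lemma asy_error_cong_lower:
  assumes "\<forall>k<m. G $$ k = 0" "\<forall>k<m'. G $$ k = 0"
  shows "asy_error f G m N = asy_error f G m' N"
proof -
  have "(\<Sum>k\<in>{m..<N}. G $$ k * dfact_int (int n - k)) = (\<Sum>k\<in>{m'..<N}. G $$ k * dfact_int (int n - k))" for n
    by (rule sum.mono_neutral_cong) (use assms in \<open>auto simp: not_le\<close>)
  then show ?thesis by (simp add: asy_error_def fun_eq_iff)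
qed

text \<open>The sum may start at any index below which \<open>G\<close> vanishes, so expansions of
  several series can be put on a common range.\<close>

lemma asy_iff:
  assumes "\<forall>k<m. G $$ k = 0"
  shows "asy f G \<longleftrightarrow> (\<forall>N. asy_error f G m N \<in> O(\<lambda>n. dfact_int (int n - N)))"
proof -
  have "asy_error f G (fls_subdegree G) N = asy_error f G m N" for N
    using assms by (intro asy_error_cong_lower) auto
  then show ?thesis by (simp add: asy_def)
qed

text \<open>Finitely many coefficients and all negative powers of \<hbar> are invisible to the
  expansion. This later discards explicit terms such as j/\<hbar>.\<close>

lemma asy_cong:
  assumes "asy f G" "eventually (\<lambda>n. f $$ int n = f' $$ int n) at_top"
  shows "asy f' G"
  unfolding asy_def
proof
  fix N
  have "eventually (\<lambda>n. asy_error f G (fls_subdegree G) N n = asy_error f' G (fls_subdegree G) N n) at_top"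
    using assms(2) by eventually_elim (simp add: asy_error_def)
  then show "asy_error f' G (fls_subdegree G) N \<in> O(\<lambda>n. dfact_int (int n - N))"
    using assms(1) landau_o.big.in_cong unfolding asy_def by blast
qed

lemma asy_add:
  assumes "asy f G" "asy f' G'"
  shows "asy (f + f') (G + G')"
proof -
  define m where "m = min (fls_subdegree G) (fls_subdegree G')"
  have m: "\<forall>k<m. G $$ k = 0" "\<forall>k<m. G' $$ k = 0" "\<forall>k<m. (G + G') $$ k = 0"
    by (auto simp: m_def)
  have "asy_error (f + f') (G + G') m N = (\<lambda>n. asy_error f G m N n + asy_error f' G' m N n)" for N
    by (simp add: asy_error_def fun_eq_iff sum.distrib algebra_simps)
  then show ?thesis
    using assms unfolding asy_iff[OF m(1)] asy_iff[OF m(2)] asy_iff[OF m(3)]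
    by (simp add: sum_in_bigo)
qed

lemma asy_scale:
  assumes "asy f G"
  shows "asy (fls_const c * f) (fls_const c * G)"
proof -
  have m: "\<forall>k<fls_subdegree G. G $$ k = 0" "\<forall>k<fls_subdegree G. (fls_const c * G) $$ k = 0"
    by auto
  have "asy_error (fls_const c * f) (fls_const c * G) (fls_subdegree G) N =
      (\<lambda>n. c * asy_error f G (fls_subdegree G) N n)" for N
    by (simp add: asy_error_def fun_eq_iff sum_distrib_left algebra_simps)
  then show ?thesis
    using assms unfolding asy_iff[OF m(1)] asy_iff[OF m(2)] by simp
qed

lemma asy_diff:
  assumes "asy f G" "asy f' G'"
  shows "asy (f - f') (G - G')"
  using asy_add[OF assms(1) asy_scale[OF assms(2), of "-1"]] by simp

lemma asy_of_nat_mult: "asy f G \<Longrightarrow> asy (of_nat n * f) (of_nat n * G)"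
  using asy_scale[of f G "of_nat n"] by (simp add: fls_of_nat)

lemma asy_shift:
  assumes "asy f G"
  shows "asy (fls_shift p f) (fls_shift p G)"
proof -
  define m where "m = fls_subdegree G"
  have m: "\<forall>k<m. G $$ k = 0"
    by (auto simp: m_def)
  have m': "\<forall>k<m - p. fls_shift p G $$ k = 0"
    by (auto simp: m_def)
  show ?thesis
    unfolding asy_iff[OF m']
  proof
    fix N
    have "asy_error f G m (N + p) \<in> O(\<lambda>n. dfact_int (int n - (N + p)))"
      using assms unfolding asy_iff[OF m] by blast
    \<comment> \<open>The shifted index has to be a natural number; the truncation in
      \<open>nat (int n + p)\<close> is eventually harmless.\<close>
    moreover have lim: "filterlim (\<lambda>n. nat (int n + p)) at_top at_top"
      unfolding filterlim_at_top
    proof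
      fix Z show "eventually (\<lambda>n. Z \<le> nat (int n + p)) at_top"
        using eventually_ge_at_top[of "Z + nat \<bar>p\<bar>"] by eventually_elim linarith
    qed
    ultimately have "(\<lambda>n. asy_error f G m (N + p) (nat (int n + p))) \<in>
        O(\<lambda>n. dfact_int (int (nat (int n + p)) - (N + p)))"
      by (rule landau_o.big.compose)
    moreover have "eventually (\<lambda>n. asy_error f G m (N + p) (nat (int n + p)) =
        asy_error (fls_shift p f) (fls_shift p G) (m - p) N n) at_top"
      using eventually_ge_at_top[of "nat \<bar>p\<bar>"]
    proof eventually_elim
      case (elim n)
      have "(\<Sum>k\<in>{m..<N + p}. G $$ k * dfact_int (int n + p - k)) =
          (\<Sum>k\<in>{m - p..<N}. G $$ (k + p) * dfact_int (int n - k))"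
        by (rule sum.reindex_bij_witness[of _ "\<lambda>k. k + p" "\<lambda>k. k - p"]) (auto simp: algebra_simps)
      then show ?case using elim by (simp add: asy_error_def)
    qed
    moreover have "eventually (\<lambda>n. dfact_int (int (nat (int n + p)) - (N + p)) = dfact_int (int n - N)) at_top"
      using eventually_ge_at_top[of "nat \<bar>p\<bar>"]
    proof eventually_elim
      case (elim n)
      then have "int (nat (int n + p)) = int n + p" by linarith
      then show ?case by simp
    qed
    ultimately show "asy_error (fls_shift p f) (fls_shift p G) (m - p) N \<in> O(\<lambda>n. dfact_int (int n - N))"
      by (simp add: landau_o.big.in_cong landau_o.big.cong)
  qed
qed

lemma asy_X_mult: "asy f G \<Longrightarrow> asy (fls_X * f) (fls_X * G)"
  by (simp add: fls_X_times_conv_shift asy_shift)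

lemma asy_X_inv_mult: "asy f G \<Longrightarrow> asy (fls_X_inv * f) (fls_X_inv * G)"
  by (simp add: fls_X_inv_times_conv_shift asy_shift)

definition euler_deriv :: "real fls \<Rightarrow> real fls" where
  "euler_deriv f = fls_X * fls_deriv f"

lemma euler_deriv_nth [simp]: "euler_deriv f $$ n = of_int n * f $$ n"
  by (simp add: euler_deriv_def fls_X_times_conv_shift)

text \<open>The recursion in the form n d(n-k) = d(n-k+1)/2 + (k-1/2) d(n-k), with d for
  \<open>dfact_int\<close>. The term -1/2 is the action of \<theta> on the prefactor \<hbar>^(-1/2),
  so on the full series the operator is \<theta> + 1/(2\<hbar>).\<close>

lemma asy_euler_deriv:
  assumes "asy f G"
  shows "asy (euler_deriv f) (euler_deriv G - fls_const (1 / 2) * G + fls_const (1 / 2) * (fls_X_inv * G))"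
    (is "asy _ ?G'")
proof -
  define m where "m = fls_subdegree G"
  have m: "\<forall>k<m. G $$ k = 0"
    by (auto simp: m_def)
  have G': "?G' $$ k = (of_int k - 1 / 2) * G $$ k + 1 / 2 * G $$ (k + 1)" for k
    by (simp add: left_diff_distrib fls_X_inv_times_conv_shift(1))
  have m': "\<forall>k<m - 1. ?G' $$ k = 0"
    unfolding G' using m by auto
  show ?thesis
    unfolding asy_iff[OF m']
  proof
    fix N
    define d where "d n k = dfact_int (int n - k)" for n k
    have d: "real n * d n k = 1 / 2 * d n (k - 1) + (of_int k - 1 / 2) * d n k" for n k
      using dfact_int_rec[of "int n - k"] by (simp add: d_def algebra_simps)
    \<comment> \<open>The factor n costs one order of accuracy, so \<open>f\<close> is expanded one
      term further, up to \<open>k = N\<close>. What is left over from this last term has the size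
      of the permitted error.\<close>
    have sum_eq: "real n * (\<Sum>k\<in>{m..<N + 1}. G $$ k * d n k) =
        (\<Sum>k\<in>{m - 1..<N}. ?G' $$ k * d n k) + (of_int N - 1 / 2) * G $$ N * d n N"  for n
    proof -
      have "real n * (\<Sum>k\<in>{m..<N + 1}. G $$ k * d n k) =
          (\<Sum>k\<in>{m..<N + 1}. 1 / 2 * G $$ k * d n (k - 1)) + (\<Sum>k\<in>{m..<N + 1}. (of_int k - 1 / 2) * G $$ k * d n k)"
        unfolding sum_distrib_left sum.distrib[symmetric]
        by (rule sum.cong) (simp_all add: mult.left_commute[of "real n"] d distrib_left mult_ac)
      also have "(\<Sum>k\<in>{m..<N + 1}. 1 / 2 * G $$ k * d n (k - 1)) =
          (\<Sum>k\<in>{m - 1..<N}. 1 / 2 * G $$ (k + 1) * d n k)"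
        by (rule sum.reindex_bij_witness[of _ "\<lambda>k. k + 1" "\<lambda>k. k - 1"]) auto
      also have "(\<Sum>k\<in>{m..<N + 1}. (of_int k - 1 / 2) * G $$ k * d n k) =
          (\<Sum>k\<in>{m - 1..<N}. (of_int k - 1 / 2) * G $$ k * d n k) + (of_int N - 1 / 2) * G $$ N * d n N"
      proof (cases "N < m")
        case True
        then have "{m..<N + 1} = {}" "{m - 1..<N} = {}" by auto
        then show ?thesis using m True by simp
      next
        case False
        then have "{m..<N + 1} = insert N {m..<N}" by auto
        moreover have "(\<Sum>k\<in>{m..<N}. (of_int k - 1 / 2) * G $$ k * d n k) =
            (\<Sum>k\<in>{m - 1..<N}. (of_int k - 1 / 2) * G $$ k * d n k)"
          by (rule sum.mono_neutral_left) (auto simp: m)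
        ultimately show ?thesis by simp
      qed
      finally show ?thesis unfolding G' by (simp add: sum.distrib[symmetric] algebra_simps)
    qed
    have "(\<lambda>n. real n * asy_error f G m (N + 1) n) \<in> O(\<lambda>n. real n * dfact_int (int n - (N + 1)))"
      using assms unfolding asy_iff[OF m] by (intro landau_o.big.mult_left) auto
    also have "(\<lambda>n. real n * dfact_int (int n - (N + 1))) \<in> O(\<lambda>n. dfact_int (int n - N))"
      using of_nat_mult_dfact_int_bigo[of "N + 1"] by simp
    finally have "(\<lambda>n. real n * asy_error f G m (N + 1) n + (of_int N - 1 / 2) * G $$ N * dfact_int (int n - N))
        \<in> O(\<lambda>n. dfact_int (int n - N))"
      by (intro sum_in_bigo) auto
    also have "(\<lambda>n. real n * asy_error f G m (N + 1) n + (of_int N - 1 / 2) * G $$ N * dfact_int (int n - N)) =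
        asy_error (euler_deriv f) ?G' (m - 1) N"
      using sum_eq by (simp add: asy_error_def fun_eq_iff d_def right_diff_distrib)
    finally show "asy_error (euler_deriv f) ?G' (m - 1) N \<in> O(\<lambda>n. dfact_int (int n - N))" .
  qed
qed

text \<open>\<beta> is chosen so that \<open>c 0\<close> belongs to the leading exponent
  \<open>m - 1/2\<close> of \<hbar>^(-1/2) G.\<close>

lemma asy_has_factorial_expansion:
  assumes "asy f G"
  defines "m \<equiv> fls_subdegree G"
  shows "has_factorial_expansion (1 / 2) f (1 / 2 - of_int m) (\<lambda>k. G $$ (m + int k) / sqrt (2 * pi))"
  unfolding has_factorial_expansion_def
proof (intro conjI allI)
  fix R :: nat
  \<comment> \<open>This is 2^(k+1/2) \<Gamma>(k+1/2) = sqrt(2\<pi>) (2k-1)!!, the origin of the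
    factor 1/sqrt(2\<pi>) in all results.\<close>
  have g: "(1 / 2) powr (- real n - (1 / 2 - of_int m) + real k) *
      Gamma (real n + (1 / 2 - of_int m) - real k) = sqrt (2 * pi) * dfact_int (int n - (m + int k))" for n k
  proof -
    have "(1 / 2 :: real) powr (- real n - (1 / 2 - of_int m) + real k) =
        2 powr (of_int (int n - (m + int k)) + 1 / 2)"
      by (simp add: powr_divide powr_minus_divide[symmetric] algebra_simps)
    also have "\<dots> = sqrt 2 * 2 powr of_int (int n - (m + int k))"
      by (simp only: powr_add powr_half_sqrt) simp
    finally show ?thesis
      by (simp add: dfact_int_def real_sqrt_mult algebra_simps)
  qed
  have "(\<Sum>k\<in>{m..<m + int R}. G $$ k * dfact_int (int n - k)) =
      (\<Sum>k<R. G $$ (m + int k) * dfact_int (int n - (m + int k)))" for n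
    by (rule sum.reindex_bij_witness[of _ "\<lambda>k. m + int k" "\<lambda>k. nat (k - m)"]) auto
  then have "(\<lambda>n. f $$ int n - (\<Sum>k<R. G $$ (m + int k) / sqrt (2 * pi) *
      (1 / 2) powr (- real n - (1 / 2 - of_int m) + real k) *
      Gamma (real n + (1 / 2 - of_int m) - real k))) = asy_error f G m (m + int R)"
    by (simp add: asy_error_def fun_eq_iff mult.assoc g)
  moreover have "asy_error f G m (m + int R) \<in> O(\<lambda>n. dfact_int (int n - (m + int R)))"
    using assms unfolding asy_def m_def by blast
  moreover have "(\<lambda>n. (1 / 2) powr (- real n) * Gamma (real n + (1 / 2 - of_int m) - real R)) =
      (\<lambda>n. ((1 / 2) powr (1 / 2 - of_int m - real R) * sqrt (2 * pi)) * dfact_int (int n - (m + int R)))"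
    by (rule ext) (simp add: mult.assoc g[symmetric] powr_add[symmetric]; simp add: mult.assoc[symmetric] powr_add[symmetric] algebra_simps)
  ultimately show "(\<lambda>n. f $$ int n - (\<Sum>k<R. G $$ (m + int k) / sqrt (2 * pi) *
      (1 / 2) powr (- real n - (1 / 2 - of_int m) + real k) *
      Gamma (real n + (1 / 2 - of_int m) - real k)))
    \<in> O(\<lambda>n. (1 / 2) powr (- real n) * Gamma (real n + (1 / 2 - of_int m) - real R))"
    by simp
qed simp

lemma hbar_powr_subdegree:
  "hbar_powr (- (1 / 2 - of_int (fls_subdegree G)))
      (fps_to_fls (Abs_fps (\<lambda>k. G $$ (fls_subdegree G + int k) / sqrt (2 * pi)))) =
    hbar_powr (- (1 / 2)) (fls_const (1 / sqrt (2 * pi)) * G)"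
proof
  fix e :: real
  define m where "m = fls_subdegree G"
  have "e - (- (1 / 2 - of_int m)) = e - (- (1 / 2)) - of_int m" by simp
  moreover have "e - (- (1 / 2)) - of_int m \<in> \<int> \<longleftrightarrow> e - (- (1 / 2)) \<in> \<int>"
    by (metis Ints_add Ints_diff Ints_of_int diff_add_cancel)
  moreover have "\<lfloor>e - (- (1 / 2)) - of_int m\<rfloor> = \<lfloor>e - (- (1 / 2))\<rfloor> - m"
    by linarith
  moreover have "fps_to_fls (Abs_fps (\<lambda>k. G $$ (m + int k) / sqrt (2 * pi))) $$ (i - m) =
      (fls_const (1 / sqrt (2 * pi)) * G) $$ i" for i
    by (auto simp: m_def)
  ultimately show "hbar_powr (- (1 / 2 - of_int (fls_subdegree G)))
      (fps_to_fls (Abs_fps (\<lambda>k. G $$ (fls_subdegree G + int k) / sqrt (2 * pi)))) e =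
    hbar_powr (- (1 / 2)) (fls_const (1 / sqrt (2 * pi)) * G) e"
    unfolding hbar_powr_def m_def[symmetric] by (simp only:)
qed

lemma asy_expandable:
  assumes "asy f G"
  shows "factorially_expandable (1 / 2) f"
  using asy_has_factorial_expansion[OF assms] unfolding factorially_expandable_def by blast

section \<open>The coefficients of \<open>log \<chi>\<close>\<close>

abbreviation dfact :: "nat \<Rightarrow> real" where
  "dfact n \<equiv> real (odd_dfact n)"

lemma chi_nth [simp]: "chi $ n = dfact n"
  by (simp add: chi_def)

text \<open>Coefficientwise this is (2k+1)!! = (2k-1)!! + 2k (2k-1)!!.\<close>

lemma chi_ode: "chi = 1 + fps_X * chi + 2 * fps_X ^ 2 * fps_deriv chi"
proof (rule fps_ext)
  fix n
  show "chi $ n = (1 + fps_X * chi + 2 * fps_X ^ 2 * fps_deriv chi) $ n"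
  proof (cases n)
    case (Suc k)
    have "(2 * fps_X ^ 2 * fps_deriv chi) $ Suc k = 2 * (fps_X * (fps_X * fps_deriv chi)) $ Suc k"
      by (simp add: power2_eq_square mult.assoc numeral_fps_const)
    also have "\<dots> = 2 * real k * dfact k"
      by (cases k) simp_all
    finally show ?thesis using Suc by (simp add: algebra_simps)
  qed (simp add: power2_eq_square mult.assoc numeral_fps_const)
qed

lemma inverse_chi_mult: "inverse chi * chi = 1"
  by (rule inverse_mult_eq_1) simp

text \<open>Divide the equation for \<chi> by \<chi>^2 and use (1/\<chi>)' =
  -\<chi>'/\<chi>^2.\<close>

lemma inverse_chi_ode:
  "inverse chi ^ 2 = inverse chi - fps_X * inverse chi + 2 * fps_X ^ 2 * fps_deriv (inverse chi)"
proof -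
  let ?E = "inverse chi"
  have d: "fps_deriv ?E = - fps_deriv chi * ?E ^ 2"
    by (rule fps_inverse_deriv) simp
  have sq: "?E ^ 2 * chi = ?E"
    using inverse_chi_mult by (simp add: power2_eq_square mult.assoc)
  then have "?E = ?E ^ 2 * chi" by (rule sym)
  also have "\<dots> = ?E ^ 2 * (1 + fps_X * chi + 2 * fps_X ^ 2 * fps_deriv chi)"
    using chi_ode by (rule arg_cong)
  also have "\<dots> = ?E ^ 2 + fps_X * (?E ^ 2 * chi) - 2 * fps_X ^ 2 * fps_deriv ?E"
    unfolding d by algebra
  also have "?E ^ 2 * chi = ?E" by (rule sq)
  finally have "?E = ?E ^ 2 + fps_X * ?E - 2 * fps_X ^ 2 * fps_deriv ?E" .
  then show ?thesis by algebra
qed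

text \<open>The number of indecomposable perfect matchings of \<open>2n\<close> points on a line, for \<open>n > 0\<close>.\<close>
definition indec :: "nat \<Rightarrow> real" where
  "indec n = - (inverse chi $ n)"

lemma inverse_chi_nth: "inverse chi $ n = - indec n"
  by (simp add: indec_def)

lemma indec_0: "indec 0 = - 1"
  by (simp add: indec_def)

lemma inverse_chi_square_nth:
  "(inverse chi ^ 2) $ Suc n = - indec (Suc n) - (2 * real n - 1) * indec n"
proof -
  have "(2 * fps_X ^ 2 * fps_deriv (inverse chi)) $ Suc n = 2 * (fps_X * (fps_X * fps_deriv (inverse chi))) $ Suc n"
    by (simp add: power2_eq_square mult.assoc numeral_fps_const)
  also have "\<dots> = - 2 * real n * indec n"
    by (cases n) (simp_all add: inverse_chi_nth del: of_nat_Suc)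
  finally show ?thesis
    by (subst inverse_chi_ode) (simp add: inverse_chi_nth algebra_simps)
qed

lemma indec_1: "indec (Suc 0) = 1"
  using fps_mult_nth[of "inverse chi" chi 1] inverse_chi_mult by (simp add: inverse_chi_nth indec_0)

text \<open>The coefficient of (1/\<chi>)^2 is computed both from the differential equation and as a
  convolution, whose two end terms carry \<open>indec 0 = - 1\<close>. All coefficients of the
  resulting recursion are nonnegative, which yields nonnegativity of \<open>indec\<close>.\<close>

lemma indec_rec:
  assumes "n > 0"
  shows "indec (Suc n) = (2 * real n - 1) * indec n + (\<Sum>k = 1..n. indec k * indec (Suc n - k))"
proof -
  have "(inverse chi ^ 2) $ Suc n = (\<Sum>k = 0..Suc n. indec k * indec (Suc n - k))"
    by (simp add: power2_eq_square fps_mult_nth inverse_chi_nth)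
  also have "\<dots> = (\<Sum>k = 1..n. indec k * indec (Suc n - k)) - 2 * indec (Suc n)"
    by (simp add: sum.atLeast_Suc_atMost[of 0] sum.atLeast0_atMost_Suc indec_0)
  finally show ?thesis
    using inverse_chi_square_nth[of n] by simp
qed

lemma indec_nonneg: "n > 0 \<Longrightarrow> indec n \<ge> 0"
proof (induction n rule: less_induct)
  case (less n)
  show ?case
  proof (cases "n = 1")
    case False
    then obtain k where k: "n = Suc k" "k > 0" using less.prems by (cases n) auto
    have "(\<Sum>i = 1..k. indec i * indec (Suc k - i)) \<ge> 0"
      using less.IH k by (intro sum_nonneg mult_nonneg_nonneg) auto
    moreover have "(2 * real k - 1) * indec k \<ge> 0"
      using less.IH[of k] k by (intro mult_nonneg_nonneg) auto
    ultimately show ?thesis using k indec_rec by simp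
  qed (simp add: indec_1)
qed

lemma dfact_decompose:
  assumes "n > 0" shows "(\<Sum>k\<le>n. dfact k * indec (n - k)) = 0"
proof -
  have "(chi * inverse chi) $ n = (1 :: real fps) $ n"
    using inverse_chi_mult by (simp add: mult.commute)
  then show ?thesis
    using assms by (simp add: fps_mult_nth inverse_chi_nth sum_negf atLeast0AtMost)
qed

text \<open>In \<chi> (1/\<chi>) = 1 the double factorial is \<open>indec n\<close> plus nonnegative
  terms.\<close>

lemma abs_indec_le: "\<bar>indec n\<bar> \<le> dfact n"
proof (cases n)
  case (Suc m)
  have "0 = (\<Sum>k<n. dfact k * indec (n - k)) + dfact n * indec 0"
    using dfact_decompose[of n] Suc by (simp flip: lessThan_Suc_atMost)
  also have "(\<Sum>k<n. dfact k * indec (n - k)) = indec n + (\<Sum>k = 1..<n. dfact k * indec (n - k))"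
    using Suc by (simp add: sum.atLeast_Suc_lessThan lessThan_atLeast0)
  finally have "dfact n = indec n + (\<Sum>k = 1..<n. dfact k * indec (n - k))"
    by (simp add: indec_0)
  moreover have "(\<Sum>k = 1..<n. dfact k * indec (n - k)) \<ge> 0"
    by (intro sum_nonneg mult_nonneg_nonneg indec_nonneg) auto
  ultimately show ?thesis using indec_nonneg[of n] Suc by simp
qed (simp add: indec_0)

section \<open>Convolutions of double factorials and the expansion of 1/\<chi>\<close>

text \<open>Log-convexity: for a fixed sum of the two indices, both at least \<open>r\<close>, the
  product is largest at the ends.\<close>

lemma dfact_mult_le: "dfact (r + i) * dfact (r + j) \<le> dfact r * dfact (r + i + j)"
proof (induction i)
  case (Suc i)
  have "dfact (r + Suc i) * dfact (r + j) = (2 * real (r + i) + 1) * (dfact (r + i) * dfact (r + j))"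
    by (simp add: algebra_simps)
  also have "\<dots> \<le> (2 * real (r + i + j) + 1) * (dfact r * dfact (r + i + j))"
    by (rule mult_mono[OF _ Suc]) simp_all
  also have "\<dots> = dfact r * dfact (r + Suc i + j)"
    by (simp add: algebra_simps)
  finally show ?case .
qed simp

text \<open>Each inner term is at most the outermost one, and their number, at most n, is absorbed
  by one step of the recursion.\<close>

lemma dfact_convolution_le:
  assumes "n \<ge> 2 * r + 2"
  shows "(\<Sum>k = Suc r..n - Suc r. dfact k * dfact (n - k)) \<le> 2 * dfact (Suc r) * dfact (n - r)"
proof -
  have "(\<Sum>k = Suc r..n - Suc r. dfact k * dfact (n - k)) \<le>
      (\<Sum>k = Suc r..n - Suc r. dfact (Suc r) * dfact (n - Suc r))"
  proof (rule sum_mono)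
    fix k assume "k \<in> {Suc r..n - Suc r}"
    then have "k = Suc r + (k - Suc r)" "n - k = Suc r + (n - k - Suc r)"
      "n - Suc r = Suc r + (k - Suc r) + (n - k - Suc r)"
      using assms by auto
    then show "dfact k * dfact (n - k) \<le> dfact (Suc r) * dfact (n - Suc r)"
      using dfact_mult_le[of "Suc r" "k - Suc r" "n - k - Suc r"] by metis
  qed
  also have "\<dots> = dfact (Suc r) * (real (n - Suc r - r) * dfact (n - Suc r))"
    using assms by (simp add: Suc_diff_Suc)
  also have "\<dots> \<le> dfact (Suc r) * (2 * dfact (n - r))"
  proof (rule mult_left_mono)
    have "n - r = Suc (n - Suc r)" using assms by simp
    then have "dfact (n - r) = (2 * real (n - Suc r) + 1) * dfact (n - Suc r)"
      by (simp only: odd_dfact_Suc of_nat_mult) simp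
    moreover have "real (n - Suc r - r) * dfact (n - Suc r) \<le> (2 * (2 * real (n - Suc r) + 1)) * dfact (n - Suc r)"
      by (rule mult_right_mono) auto
    ultimately show "real (n - Suc r - r) * dfact (n - Suc r) \<le> 2 * dfact (n - r)" by simp
  qed simp
  finally show ?thesis by (simp only: mult_ac)
qed

lemma indec_convolution_bigo:
  "(\<lambda>n. (\<Sum>k<R. dfact k * indec (n - k)) + (\<Sum>k<R. indec k * dfact_int (int n - int k)))
    \<in> O(\<lambda>n. dfact_int (int n - int R))" (is "?c \<in> _")
\<comment> \<open>After removing \<open>R\<close> terms at each end of the vanishing convolution,
  \<open>2 * dfact R\<close> accounts for the outermost remaining terms \<open>k = R\<close> and
  \<open>k = n - R\<close>, and \<open>2 * dfact (Suc R)\<close> for those strictly between.\<close>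
proof (rule bigoI[of _ "2 * dfact (Suc R) + 2 * dfact R"])
  show "\<forall>\<^sub>F n in at_top. norm (?c n) \<le> (2 * dfact (Suc R) + 2 * dfact R) * norm (dfact_int (int n - int R))"
    using eventually_ge_at_top[of "2 * R + 2"]
  proof eventually_elim
    case (elim n)
    let ?t = "\<lambda>k. dfact k * indec (n - k)"
    have *: "dfact_int (int n - int k) = dfact (n - k)" if "k \<le> n" for k
      using dfact_int_of_nat[of "n - k"] that by (simp add: of_nat_diff)
    have "0 = (\<Sum>k\<le>n. ?t k)"
      using dfact_decompose[of n] elim by simp
    also have "{..n} = {..<R} \<union> ({R..n - R} \<union> {n - R<..n})"
      using elim by auto
    also have "(\<Sum>k\<in>\<dots>. ?t k) = (\<Sum>k<R. ?t k) + ((\<Sum>k\<in>{R..n - R}. ?t k) + (\<Sum>k\<in>{n - R<..n}. ?t k))"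
      using elim by (subst sum.union_disjoint; (subst sum.union_disjoint)?) auto
    also have "(\<Sum>k\<in>{n - R<..n}. ?t k) = (\<Sum>k<R. indec k * dfact_int (int n - int k))"
      by (rule sum.reindex_bij_witness[of _ "\<lambda>k. n - k" "\<lambda>k. n - k"]) (use elim in \<open>auto simp: dfact_int_of_nat\<close>)
    finally have "norm (?c n) = \<bar>\<Sum>k\<in>{R..n - R}. ?t k\<bar>"
      unfolding real_norm_def by linarith
    also have "\<dots> \<le> (\<Sum>k\<in>{R..n - R}. dfact k * dfact (n - k))"
      by (rule order.trans[OF sum_abs]) (auto intro!: sum_mono mult_left_mono abs_indec_le simp: abs_mult)
    also have "{R..n - R} = insert R (insert (n - R) {Suc R..n - Suc R})"
      using elim by auto
    also have "(\<Sum>k\<in>\<dots>. dfact k * dfact (n - k)) =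
        2 * dfact R * dfact (n - R) + (\<Sum>k = Suc R..n - Suc R. dfact k * dfact (n - k))"
      using elim by (subst sum.insert; (subst sum.insert)?) auto
    also have "\<dots> \<le> 2 * dfact R * dfact (n - R) + 2 * dfact (Suc R) * dfact (n - R)"
      using dfact_convolution_le[OF elim] by simp
    also have "\<dots> = (2 * dfact (Suc R) + 2 * dfact R) * norm (dfact_int (int n - int R))"
      using elim by (simp add: * algebra_simps)
    finally show ?case .
  qed
qed

text \<open>The error in the expansion that corresponds to \<A>(1/\<chi>) = -\<A>\<chi> /
  \<chi>^2.\<close>

definition indec_error :: "nat \<Rightarrow> nat \<Rightarrow> real" where
  "indec_error R n = indec n - (\<Sum>k<R. (inverse chi ^ 2) $ k * dfact_int (int n - int k))"

text \<open>Inserting the truncated expansion into each \<open>indec (n - k)\<close> produces the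
  coefficients of \<chi> (1/\<chi>)^2 = 1/\<chi>, that is \<open>- indec s\<close>, which cancel the
  second sum.\<close>

lemma indec_error_convolution:
  assumes "n \<ge> R"
  shows "(\<Sum>k<R. dfact k * indec (n - k)) + (\<Sum>k<R. indec k * dfact_int (int n - int k)) =
    (\<Sum>k<R. dfact k * indec_error (R - k) (n - k))"
proof -
  define D where "D = inverse chi ^ 2"
  define M where "M k = dfact_int (int n - int k)" for k
  have "(\<Sum>k<R. dfact k * (\<Sum>i<R - k. D $ i * dfact_int (int (n - k) - int i))) =
      (\<Sum>k<R. \<Sum>i<R - k. dfact k * D $ i * M (k + i))"
    unfolding sum_distrib_left
    by (intro sum.cong) (use assms in \<open>auto simp: M_def of_nat_diff algebra_simps\<close>)
  also have "\<dots> = (\<Sum>(k, i)\<in>Sigma {..<R} (\<lambda>k. {..<R - k}). dfact k * D $ i * M (k + i))"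
    by (rule sum.Sigma) auto
  also have "Sigma {..<R} (\<lambda>k. {..<R - k}) = {(k, i). k + i < R}"
    by auto
  also have "(\<Sum>(k, i)\<in>\<dots>. dfact k * D $ i * M (k + i)) =
      (\<Sum>s<R. \<Sum>k\<le>s. dfact k * D $ (s - k) * M (k + (s - k)))"
    by (rule sum.triangle_reindex)
  also have "\<dots> = (\<Sum>s<R. - indec s * M s)"
  proof (rule sum.cong)
    fix s
    have "(chi * D) $ s = inverse chi $ s"
      unfolding D_def power2_eq_square mult.assoc[symmetric]
      using inverse_chi_mult by (simp add: mult.commute)
    then have "(\<Sum>k\<le>s. dfact k * D $ (s - k)) = - indec s"
      by (simp add: fps_mult_nth inverse_chi_nth atLeast0AtMost)
    then show "(\<Sum>k\<le>s. dfact k * D $ (s - k) * M (k + (s - k))) = - indec s * M s"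
      by (simp flip: sum_distrib_right)
  qed simp
  finally show ?thesis
    by (simp add: indec_error_def D_def M_def right_diff_distrib sum_subtractf sum_negf)
qed

text \<open>Since \<open>dfact 0 = 1\<close>, the term \<open>k = 0\<close> of the convolution
  identity is the error of order \<open>R\<close> itself. The other terms involve smaller orders at
  shifted arguments and are covered by induction; their shifts add up to \<open>R\<close>
  again.\<close>

lemma indec_error_bigo: "indec_error R \<in> O(\<lambda>n. dfact_int (int n - int R))"
proof (induction R rule: less_induct)
  case (less R)
  show ?case
  proof (cases R)
    case 0
    show ?thesis
      by (rule bigoI[of _ 1]) (simp add: 0 indec_error_def dfact_int_of_nat abs_indec_le)
  next
    case (Suc Q)
    define c where "c n = (\<Sum>k<R. dfact k * indec (n - k)) + (\<Sum>k<R. indec k * dfact_int (int n - int k))" for n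
    have "(\<lambda>n. indec_error (Q - k) (n - Suc k)) \<in> O(\<lambda>n. dfact_int (int n - int R))" if "k < Q" for k
    proof -
      have "indec_error (Q - k) \<in> O(\<lambda>n. dfact_int (int n - int (Q - k)))"
        using less.IH[of "Q - k"] Suc by simp
      moreover have "filterlim (\<lambda>n. n - Suc k) at_top at_top"
        by (rule filterlim_minus_const_nat_at_top)
      ultimately have "(\<lambda>n. indec_error (Q - k) (n - Suc k)) \<in>
          O(\<lambda>n. dfact_int (int (n - Suc k) - int (Q - k)))"
        by (rule landau_o.big.compose)
      moreover have "\<forall>\<^sub>F n in at_top. dfact_int (int (n - Suc k) - int (Q - k)) = dfact_int (int n - int R)"
        using eventually_ge_at_top[of "Suc k"]
        by eventually_elim (use that Suc in \<open>simp add: of_nat_diff algebra_simps\<close>)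
      ultimately show ?thesis by (simp add: landau_o.big.cong)
    qed
    then have "(\<lambda>n. c n - (\<Sum>k<Q. dfact (Suc k) * indec_error (Q - k) (n - Suc k))) \<in>
        O(\<lambda>n. dfact_int (int n - int R))"
      unfolding c_def by (intro sum_in_bigo(2) big_sum_in_bigo indec_convolution_bigo) simp
    moreover have cong: "\<forall>\<^sub>F n in at_top.
        c n - (\<Sum>k<Q. dfact (Suc k) * indec_error (Q - k) (n - Suc k)) = indec_error R n"
      using eventually_ge_at_top[of R]
    proof eventually_elim
      case (elim n)
      show ?case
        unfolding c_def indec_error_convolution[OF elim]
        by (simp add: Suc sum.lessThan_Suc_shift del: sum.lessThan_Suc odd_dfact_Suc)
    qed
    ultimately show ?thesis unfolding landau_o.big.in_cong[OF cong] by simp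
  qed
qed

text \<open>
  The hypothesis says that \<open>f\<close> is \<open>log \<chi>\<close> up to its constant term, by the differential equation of \<open>\<chi>\<close>.
\<close>
lemma asy_log_chi:
  assumes f: "\<And>n::nat. n > 0 \<Longrightarrow> 2 * real n * f $$ int n = indec (Suc n)"
  shows "asy f (fps_to_fls (inverse chi))"
proof -
  have lower: "\<forall>k<0. fps_to_fls (inverse chi) $$ k = 0" by simp
  have nat: "asy_error f (fps_to_fls (inverse chi)) 0 (int R) \<in> O(\<lambda>n. dfact_int (int n - int R))" for R
  proof -
    define e where "e k = inverse chi $ k" for k
    define D where "D = inverse chi ^ 2"
    have D: "D $ Suc k = e (Suc k) + (2 * real k - 1) * e k" for k
      unfolding D_def e_def inverse_chi_square_nth inverse_chi_nth by simp
    have D0: "D $ 0 = e 0" by (simp add: D_def e_def power2_eq_square)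
    have err: "asy_error f (fps_to_fls (inverse chi)) 0 (int R) n =
        f $$ int n - (\<Sum>k<R. e k * dfact_int (int n - int k))" for n
    proof -
      have "(\<Sum>k\<in>{0..<int R}. fps_to_fls (inverse chi) $$ k * dfact_int (int n - k)) =
          (\<Sum>k<R. e k * dfact_int (int n - int k))"
        by (rule sum.reindex_bij_witness[of _ int nat]) (auto simp: e_def)
      then show ?thesis by (simp add: asy_error_def)
    qed
    \<comment> \<open>The factor \<open>2 * n\<close> turns the coefficients of 1/\<chi> into those
      of (1/\<chi>)^2, hence the claim for \<open>f\<close> into the expansion of
      \<open>indec (Suc n)\<close>. The truncations differ by the boundary term with
      \<open>e R\<close>.\<close>
    have eq: "2 * real n * asy_error f (fps_to_fls (inverse chi)) 0 (int R) n =
        indec_error (Suc R) (Suc n) + e R * dfact_int (int (Suc n) - int R)" if "n > 0" for n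
    proof -
      define M where "M k = dfact_int (int (Suc n) - int k)" for k
      have M: "2 * real n * dfact_int (int n - int k) = M k + (2 * real k - 1) * M (Suc k)" for k
        using dfact_int_rec[of "int n - int k"] by (simp add: M_def algebra_simps)
      have "2 * real n * (\<Sum>k<R. e k * dfact_int (int n - int k)) =
          (\<Sum>k<R. e k * M k + (2 * real k - 1) * e k * M (Suc k))"
        unfolding sum_distrib_left
      proof (rule sum.cong)
        fix k
        have "2 * real n * (e k * dfact_int (int n - int k)) = e k * (2 * real n * dfact_int (int n - int k))"
          by (simp only: mult_ac)
        also have "\<dots> = e k * M k + (2 * real k - 1) * e k * M (Suc k)"
          unfolding M by (simp only: distrib_left mult_ac)
        finally show "2 * real n * (e k * dfact_int (int n - int k)) = e k * M k + (2 * real k - 1) * e k * M (Suc k)" .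
      qed simp
      also have "\<dots> = (\<Sum>k<Suc R. D $ k * M k) - e R * M R"
      proof -
        have "(\<Sum>k<Suc R. D $ k * M k) = e 0 * M 0 + (\<Sum>k<R. (e (Suc k) + (2 * real k - 1) * e k) * M (Suc k))"
          by (simp only: sum.lessThan_Suc_shift D D0)
        also have "\<dots> = (\<Sum>k<Suc R. e k * M k) + (\<Sum>k<R. (2 * real k - 1) * e k * M (Suc k))"
          by (simp only: sum.lessThan_Suc_shift[of "\<lambda>k. e k * M k"] distrib_right sum.distrib add.assoc)
        finally show ?thesis by (simp add: sum.distrib)
      qed
      finally show ?thesis
        using f[OF that] unfolding err right_diff_distrib indec_error_def D_def[symmetric] M_def by simp
    qed
    have "(\<lambda>n. indec_error (Suc R) (Suc n) + e R * dfact_int (int (Suc n) - int R)) \<in>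
        O(\<lambda>n. dfact_int (int (Suc n) - int R))"
    proof (intro sum_in_bigo)
      have "indec_error (Suc R) \<in> O(\<lambda>n. dfact_int (int n - int R))"
        by (rule landau_o.big_trans[OF indec_error_bigo dfact_int_bigo_mono]) simp
      then show "(\<lambda>n. indec_error (Suc R) (Suc n)) \<in> O(\<lambda>n. dfact_int (int (Suc n) - int R))"
        by (rule landau_o.big.compose) (rule filterlim_Suc)
    qed simp
    also have "(\<lambda>n. dfact_int (int (Suc n) - int R)) \<in> O(\<lambda>n. real n * dfact_int (int n - int R))"
      using dfact_int_bigo_mult_of_nat[of "int R"] by (simp add: algebra_simps)
    also have "(\<lambda>n. real n * dfact_int (int n - int R)) \<in> O(\<lambda>n. 2 * real n * dfact_int (int n - int R))"
      by (simp add: mult.assoc)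
    finally have "(\<lambda>n. indec_error (Suc R) (Suc n) + e R * dfact_int (int (Suc n) - int R)) \<in>
      O(\<lambda>n. 2 * real n * dfact_int (int n - int R))" .
    moreover have cong: "\<forall>\<^sub>F n in at_top. indec_error (Suc R) (Suc n) + e R * dfact_int (int (Suc n) - int R) =
        2 * real n * asy_error f (fps_to_fls (inverse chi)) 0 (int R) n"
      using eventually_gt_at_top[of 0] by eventually_elim (use eq in simp)
    ultimately have "(\<lambda>n. 2 * real n * asy_error f (fps_to_fls (inverse chi)) 0 (int R) n) \<in>
        O(\<lambda>n. 2 * real n * dfact_int (int n - int R))"
      unfolding landau_o.big.in_cong[OF cong] by simp
    moreover have "\<forall>\<^sub>F n in at_top. 2 * real n \<noteq> 0"
      using eventually_gt_at_top[of 0] by eventually_elim simp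
    ultimately show ?thesis
      by (subst (asm) landau_o.big.mult_cancel_left) simp_all
  qed
  show ?thesis
    unfolding asy_iff[OF lower]
  proof
    fix N :: int
    show "asy_error f (fps_to_fls (inverse chi)) 0 N \<in> O(\<lambda>n. dfact_int (int n - N))"
    proof (cases "N \<ge> 0")
      case True
      then show ?thesis using nat[of "nat N"] by simp
    next
      case False
      then have "asy_error f (fps_to_fls (inverse chi)) 0 N = asy_error f (fps_to_fls (inverse chi)) 0 (int 0)"
        by (simp add: asy_error_def fun_eq_iff)
      also have "\<dots> \<in> O(\<lambda>n. dfact_int (int n - int 0))" by (rule nat)
      also have "(\<lambda>n. dfact_int (int n - int 0)) \<in> O(\<lambda>n. dfact_int (int n - N))"
        by (rule dfact_int_bigo_mono) (use False in simp)
      finally show ?thesis .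
    qed
  qed
qed

section \<open>The weights of j and \<hbar>, and the derivations d/dj and \<hbar> d/d\<hbar>\<close>

abbreviation hb :: "real fls fps" where "hb \<equiv> fps_const fls_X"
abbreviation hbi :: "real fls fps" where "hbi \<equiv> fps_const fls_X_inv"

lemma hb_mult_hbi: "hb * hbi = 1"
  by (simp add: fls_X_times_conv_shift fls_X_inv_conv_shift_1)

lemma hval_X: "hval 2 fps_X"
  by (simp add: hval_def fps_X_def)

lemma hval_hb: "hval 1 hb"
  by (simp add: hval_def)

lemma hval_hbi: "hval (-1) hbi"
  by (simp add: hval_def)

lemma hderivation_fps_deriv: "hderivation fps_deriv"
proof -
  have "hval (d - 2) (fps_deriv F)" if "hval d F" for d F
    unfolding hval_def
  proof (intro allI impI)
    fix i k assume "k < d - 2 - 2 * int i"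
    then have "F $ (i + 1) $$ k = 0" by (intro hvalD[OF that]) simp
    then show "fps_deriv F $ i $$ k = 0" by (simp only: fps_deriv_nth fls_mult_of_nat_nth mult_zero_right)
  qed
  then show ?thesis by (auto simp: hderivation_def)
qed

definition theta :: "real fls fps \<Rightarrow> real fls fps" where
  "theta F = Abs_fps (\<lambda>a. euler_deriv (F $ a))"

lemma theta_nth [simp]: "theta F $ a = euler_deriv (F $ a)"
  by (simp add: theta_def)

lemma euler_deriv_mult: "euler_deriv (f * g) = f * euler_deriv g + euler_deriv f * g"
  by (simp add: euler_deriv_def algebra_simps)

lemma euler_deriv_add: "euler_deriv (f + g) = euler_deriv f + euler_deriv g"
  by (simp add: euler_deriv_def algebra_simps)

lemma euler_deriv_sum: "euler_deriv (sum f A) = (\<Sum>x\<in>A. euler_deriv (f x))"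
  by (simp add: euler_deriv_def fls_deriv_sum sum_distrib_left)

lemma hderivation_theta: "hderivation theta"
  unfolding hderivation_def
proof (intro conjI allI impI)
  fix F G :: "real fls fps"
  show "theta (F + G) = theta F + theta G"
    by (rule fps_ext) (simp add: euler_deriv_add)
  show "theta (F * G) = F * theta G + theta F * G"
    by (rule fps_ext) (simp add: fps_mult_nth euler_deriv_sum euler_deriv_mult sum.distrib)
next
  fix c show "theta (rconst c) = 0"
    by (rule fps_ext) (simp add: euler_deriv_def)
next
  fix d F assume "hval d F"
  then show "hval (d - 2) (theta F)" by (simp add: hval_def)
qed

lemma theta_mult: "theta (F * G) = F * theta G + theta F * G"
  using hderivation_theta by (simp add: hderivation_def)

lemma theta_X [simp]: "theta fps_X = 0"
  by (rule fps_ext) (simp add: fps_X_def euler_deriv_def)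

lemma theta_hb [simp]: "theta hb = hb"
  by (rule fps_ext) (simp add: euler_deriv_def)

lemma theta_hbi [simp]: "theta hbi = - hbi"
proof -
  have "euler_deriv fls_X_inv = - fls_X_inv"
    by (rule fls_eqI) simp
  moreover have "euler_deriv 0 = 0"
    by (simp add: euler_deriv_def)
  ultimately show ?thesis
    by (intro fps_ext) simp
qed

lemma theta_rconst [simp]: "theta (rconst c) = 0"
  using hderivation_theta by (simp add: hderivation_def)

lemma theta_one_minus_X [simp]: "theta (1 - fps_X) = 0"
  by (rule fps_ext) (simp add: fps_X_def euler_deriv_def)

lemma theta_diff: "theta (F - G) = theta F - theta G"
  by (rule fps_ext) (simp add: euler_deriv_def algebra_simps)

lemma fps_linear_ode_unique:
  fixes F G C :: "real fls fps"
  assumes "fps_deriv F = C * F" "fps_deriv G = C * G" "F $ 0 = G $ 0"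
  shows "F = G"
proof (rule fps_ext)
  fix n show "F $ n = G $ n"
  proof (induction n rule: less_induct)
    case (less n)
    show ?case
    proof (cases n)
      case (Suc m)
      have "(C * F) $ m = (C * G) $ m"
        unfolding fps_mult_nth by (intro sum.cong) (use less.IH Suc in auto)
      then have "of_nat (Suc m) * F $ n = of_nat (Suc m) * G $ n"
        using assms(1,2) Suc by (metis fps_deriv_nth Suc_eq_plus1)
      then show ?thesis by (metis mult_cancel_left of_nat_eq_0_iff nat.distinct(1))
    qed (use assms(3) in simp)
  qed
qed

section \<open>Orders 0 and 1 in \<open>|\<eta>|\<^sup>2\<close>\<close>

lemma subst_nth_0: "subst F u $ 0 = fsub F (u $ 0)"
  by (simp add: subst_def fsub_def fps_power_zeroth)

text \<open>First-order Taylor formula: the |\<eta>|^2 coefficient of \<open>u ^ n\<close> is n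
  \<open>(u $ 0) ^ (n - 1) * u $ 1\<close>. The weight \<open>d\<close> of \<open>u $ 1\<close> is
  arbitrary, as the order 1 part of Z has weight -1.\<close>

lemma subst_nth_1:
  assumes "hval 1 (u $ 0)" "hval d (u $ 1)"
  shows "subst F u $ 1 = fsub (fps_deriv F) (u $ 0) * u $ 1"
proof (rule hval_eqI)
  fix b
  define v u1 where "v = u $ 0" and "u1 = u $ 1"
  define P where "P n = rconst (F $ n) * (u ^ n) $ 1" for n
  have v: "hval 1 v" and u1: "hval d u1" using assms by (simp_all add: v_def u1_def)
  have pow: "(u ^ n) $ 1 = of_nat n * v ^ (n - 1) * u1" for n
    unfolding v_def u1_def
  proof (induction n)
    case (Suc n)
    then show ?case by (cases n) (simp_all add: fps_mult_nth fps_power_zeroth algebra_simps)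
  qed simp
  have hn: "of_nat n = rconst (real n)" for n
    by (metis fls_of_nat fps_of_nat)
  \<comment> \<open>One unit for the lost factor \<open>v\<close>, the rest for a negative weight of
    \<open>u1\<close>.\<close>
  define c where "c = 1 + nat \<bar>d\<bar>"
  have P: "hval (int n - int c) (P n)" for n
  proof (cases n)
    case 0
    then show ?thesis by (simp add: P_def pow)
  next
    case (Suc m)
    have "hval (int m + d) (v ^ m * u1)"
      by (intro hval_mult hval_power v u1)
    then have "hval (int m + d) (P n)"
      unfolding P_def pow hn mult.assoc by (intro hval_const_mult) (simp add: Suc)
    then show ?thesis by (rule hval_mono) (simp add: Suc c_def)
  qed
  define B where "B = b + c"
  have eq: "(\<Sum>n<Suc B. P n) = (\<Sum>n<B. rconst (fps_deriv F $ n) * v ^ n) * u1"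
  proof -
    have "(\<Sum>n<Suc B. P n) = (\<Sum>n<B. P (Suc n))"
      by (simp add: sum.lessThan_Suc_shift P_def pow del: sum.lessThan_Suc)
    also have "\<dots> = (\<Sum>n<B. rconst (fps_deriv F $ n) * v ^ n) * u1"
      unfolding sum_distrib_right
    proof (rule sum.cong)
      fix n
      have "rconst (fps_deriv F $ n) = rconst (F $ Suc n) * rconst (real (Suc n))"
        by (simp add: mult.commute del: of_nat_Suc)
      then show "P (Suc n) = rconst (fps_deriv F $ n) * v ^ n * u1"
        unfolding P_def pow hn by (simp only: mult_ac diff_Suc_1)
    qed simp
    finally show ?thesis .
  qed
  have "hval (int b) (subst F u $ 1 - (\<Sum>n<Suc B. P n))"
  proof -
    have "subst F u $ 1 = Abs_fps (\<lambda>a. \<Sum>n. P n $ a)"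
      by (simp add: subst_def P_def)
    then show ?thesis
      using hval_mono[OF hval_suminf[of "int c" P "Suc B"], of "int b"] P by (simp add: B_def)
  qed
  moreover have "hval (int b) ((fsub (fps_deriv F) v - (\<Sum>n<B. rconst (fps_deriv F $ n) * v ^ n)) * u1)"
    by (rule hval_mono[OF hval_mult[OF fsub_approx[OF v] u1]]) (simp add: B_def c_def)
  ultimately have "hval (int b) ((subst F u $ 1 - (\<Sum>n<Suc B. P n)) -
      (fsub (fps_deriv F) v - (\<Sum>n<B. rconst (fps_deriv F $ n) * v ^ n)) * u1)"
    by (rule hval_diff)
  then show "hval (int b) (subst F u $ 1 - fsub (fps_deriv F) (u $ 0) * u $ 1)"
    unfolding eq v_def[symmetric] u1_def[symmetric] by (simp add: algebra_simps)
qed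

lemma yseries_mult_nth_1: "(F * G) $ 1 = F $ 0 * G $ 1 + F $ 1 * (G :: yseries) $ 0"
  by (simp add: fps_mult_nth)

text \<open>The coefficients form a ring that is not a field; the hypothesis makes
  \<open>f $ 0\<close> a unit, so that \<open>inverse f\<close> is a genuine inverse and the product
  rule applies.\<close>

lemma yseries_inverse_nth:
  fixes f :: yseries
  assumes "f $ 0 $ 0 \<noteq> 0"
  shows "inverse f $ 0 = inverse (f $ 0)" "inverse f $ 1 = - (f $ 1) * inverse (f $ 0) ^ 2"
proof -
  show 0: "inverse f $ 0 = inverse (f $ 0)" by simp
  have u: "f $ 0 * inverse (f $ 0) = 1"
    using inverse_mult_eq_1'[OF assms] .
  then have "f * inverse f = 1"
    unfolding fps_inverse_def[of f] by (rule fps_right_inverse)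
  then have "(f * inverse f) $ 1 = 0" by simp
  then have "f $ 0 * inverse f $ 1 = - (f $ 1 * inverse (f $ 0))"
    unfolding yseries_mult_nth_1 0 by (simp add: eq_neg_iff_add_eq_0)
  then have "inverse (f $ 0) * (f $ 0 * inverse f $ 1) = - (f $ 1 * inverse (f $ 0)) * inverse (f $ 0)"
    by (simp add: mult.commute)
  then show "inverse f $ 1 = - (f $ 1) * inverse (f $ 0) ^ 2"
    using u by (simp add: mult.assoc[symmetric] mult.commute[of "inverse (f $ 0)" "f $ 0"] power2_eq_square)
qed

section \<open>The coefficients of the partition function\<close>

text \<open>The moment of x^(2k) contributes \<hbar>^k, so after the common factor \<hbar>^(-p) only
  \<open>m = 2 * (n + p)\<close> reaches \<hbar>^n.\<close>

lemma gauss_int_nth: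
  assumes P: "\<And>m. P $ m = fls_const (w m) * fls_X_inv ^ p"
  shows "gauss_int P $$ n = (if n + int p \<ge> 0 then w (2 * nat (n + int p)) * dfact (nat (n + int p)) else 0)"
proof -
  have t: "(P $ m * gauss_moment m) $$ n =
      (if even m \<and> n + int p = int (m div 2) then w m * dfact (m div 2) else 0)" for m n
  proof -
    have "P $ m * gauss_moment m = (if even m then fls_const (w m * dfact (m div 2)) * fls_shift (int p - int (m div 2)) 1 else 0)"
      by (simp add: P gauss_moment_def fls_X_inv_power_conv_shift_1 fls_X_power_conv_shift_1
          fls_X_intpow_times_conv_shift fls_shifted_times_simps flip: fls_const_mult_const)
    then show ?thesis by auto
  qed
  have "gauss_int P $$ n = (\<Sum>m<2 * nat (n + int p) + 1. (P $ m * gauss_moment m) $$ n)"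
    unfolding gauss_int_def
  proof (rule fls_suminf_nth)
    fix k show "\<exists>B. \<forall>m\<ge>B. \<forall>l\<le>k. (P $ m * gauss_moment m) $$ l = 0"
      unfolding t by (rule exI[of _ "2 * nat (k + int p) + 1"]) auto
  qed (unfold t, auto)
  also have "\<dots> = (\<Sum>m<2 * nat (n + int p) + 1. if m = 2 * nat (n + int p) then
      (if n + int p \<ge> 0 then w m * dfact (m div 2) else 0) else 0)"
    unfolding t by (intro sum.cong) auto
  also have "\<dots> = (if n + int p \<ge> 0 then w (2 * nat (n + int p)) * dfact (nat (n + int p)) else 0)"
    by (subst sum.delta) auto
  finally show ?thesis .
qed

lemma dfact_int_nat: "k \<ge> 0 \<Longrightarrow> dfact (nat k) = dfact_int k"
  using dfact_int_of_nat[of "nat k"] by simp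

lemma inverse_one_minus_X_nth [simp]: "inverse (1 - fps_X) $ n = (1 :: real fls)"
  by (simp add: fps_inverse_gp'[symmetric])

lemma yukawa_Z_nth_0:
  "yukawa_Z $ 0 $ a $$ n = (if 2 * (n + int a) \<ge> int a then dfact_int (n + int a) / fact a else 0)"
proof -
  have "yukawa_integrand 0 a $ m = fls_const (if m < a then 0 else 1 / fact a) * fls_X_inv ^ a" for m
  proof -
    have "yukawa_integrand 0 a = fps_X ^ a * (fps_const (fls_const (1 / fact a) * fls_X_inv ^ a) * inverse (1 - fps_X))"
      by (simp add: yukawa_integrand_def power_mult_distrib fps_const_power mult_ac flip: fps_const_mult)
    then show ?thesis by (simp add: fps_X_power_mult_nth)
  qed
  from gauss_int_nth[OF this, of n] show ?thesis
    by (auto simp: yukawa_Z_def dfact_int_nat)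
qed

text \<open>The expansion of x^a/(1-x)^2 has coefficients m-a+1 for \<open>m \<ge> a\<close>, and
  the additional 1/\<hbar> from |\<eta>|^2/\<hbar> shifts the index by one.\<close>

lemma yukawa_Z_nth_1:
  "yukawa_Z $ 1 $ a $$ n = (if 2 * (n + int a + 1) \<ge> int a
     then of_int (2 * (n + int a + 1) - int a + 1) * dfact_int (n + int a + 1) / fact a else 0)"
proof -
  have sq: "(inverse (1 - fps_X) * inverse (1 - fps_X)) $ m = (fls_const (real (m + 1)) :: real fls)" for m
  proof -
    have "(inverse (1 - fps_X) * inverse (1 - fps_X)) $ m = (of_nat (m + 1) :: real fls)"
      by (simp add: fps_mult_nth)
    then show ?thesis by (simp only: fls_of_nat)
  qed
  have "yukawa_integrand 1 a $ m =
      fls_const (if m < a then 0 else real (m - a + 1) / fact a) * fls_X_inv ^ (a + 1)" for m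
  proof -
    have "yukawa_integrand 1 a = fps_X ^ a * (fps_const (fls_const (1 / fact a) * fls_X_inv ^ (a + 1)) *
        (inverse (1 - fps_X) * inverse (1 - fps_X)))"
      by (simp add: yukawa_integrand_def power_mult_distrib fps_const_power mult_ac flip: fps_const_mult)
    then show ?thesis by (simp only: fps_X_power_mult_nth fps_mult_left_const_nth sq) (simp add: mult_ac)
  qed
  from gauss_int_nth[OF this, of n] show ?thesis
    by (auto simp: yukawa_Z_def dfact_int_nat of_nat_diff nat_diff_distrib algebra_simps)
qed

lemma yukawa_Z_0_0: "yukawa_Z $ 0 $ 0 = fps_to_fls chi"
  by (rule fls_eqI) (simp add: yukawa_Z_nth_0 dfact_int_nat[symmetric])

lemma Suc_mult_div_fact: "real (Suc a) * (x / fact (Suc a)) = x / fact a"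
  by (simp add: fact_Suc del: of_nat_Suc)

text \<open>Insertion of \<open>x\<close> into the integral is \<open>\<hbar> \<partial>/\<partial>j\<close>, and \<open>(1 - x) / (1 - x) = 1\<close> leaves a Gaussian integral.\<close>
lemma yukawa_Z_0_ode:
  "fps_deriv (yukawa_Z $ 0 - hb * fps_deriv (yukawa_Z $ 0)) =
    (fps_X * hbi) * (yukawa_Z $ 0 - hb * fps_deriv (yukawa_Z $ 0))"
proof -
  define R where "R = yukawa_Z $ 0 - hb * fps_deriv (yukawa_Z $ 0)"
  have R: "R $ a $$ n = (if 2 * (n + int a) = int a then dfact_int (n + int a) / fact a else 0)" for a n
  proof -
    have "(hb * fps_deriv (yukawa_Z $ 0)) $ a $$ n = real (Suc a) * yukawa_Z $ 0 $ Suc a $$ (n - 1)"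
      by (simp add: fls_X_times_conv_shift(1) del: of_nat_Suc)
    also have "\<dots> = (if 2 * (n + int a) \<ge> int a + 1 then dfact_int (n + int a) / fact a else 0)"
      unfolding yukawa_Z_nth_0 if_distrib[of "\<lambda>x. real (Suc a) * x"] Suc_mult_div_fact mult_zero_right
      by (rule if_cong) (auto simp: algebra_simps)
    finally show ?thesis by (simp add: R_def yukawa_Z_nth_0)
  qed
  have "fps_deriv R = fps_X * (hbi * R)"
  proof (intro fps_ext fls_eqI)
    fix a n
    have L: "fps_deriv R $ a $$ n = real (Suc a) * R $ Suc a $$ n"
      by (simp del: of_nat_Suc)
    show "fps_deriv R $ a $$ n = (fps_X * (hbi * R)) $ a $$ n"
    proof (cases a)
      case 0
      \<comment> \<open>The right-hand side has a factor j; the left-hand side vanishes by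
        parity.\<close>
      have "2 * (n + int (Suc 0)) \<noteq> int (Suc 0)" by presburger
      then have "R $ Suc 0 $$ n = 0" unfolding R by (simp only: if_False)
      then show ?thesis using L 0 by simp
    next
      case (Suc b)
      have "(fps_X * (hbi * R)) $ a $$ n = R $ b $$ (n + 1)"
        by (simp add: Suc fls_X_inv_times_conv_shift(1))
      moreover have "real (Suc a) * (dfact_int (n + int (Suc a)) / fact (Suc a)) = dfact_int (n + 1 + int b) / fact b"
        if "2 * (n + int (Suc a)) = int (Suc a)"
      proof -
        have "real_of_int (2 * (n + int a) + 1) = real_of_int (int a)" using that by (subst of_int_eq_iff) simp
        then have *: "2 * real_of_int (n + int a) + 1 = real a" by simp
        have "dfact_int (n + int (Suc a)) = real a * dfact_int (n + int a)"
          using dfact_int_rec[of "n + int a"] unfolding * by (simp add: algebra_simps)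
        moreover have "n + 1 + int b = n + int a" by (simp add: Suc)
        moreover have "dfact_int (n + int a) / fact b = real a * dfact_int (n + int a) / fact a"
          unfolding Suc times_divide_eq_right[symmetric] Suc_mult_div_fact ..
        ultimately show ?thesis by (simp only: Suc_mult_div_fact)
      qed
      moreover have "2 * (n + int (Suc a)) = int (Suc a) \<longleftrightarrow> 2 * (n + 1 + int b) = int b"
        by (auto simp: Suc)
      ultimately show ?thesis unfolding L R by simp
    qed
  qed
  then show ?thesis by (simp add: R_def mult.assoc)
qed

text \<open>Integration by parts.\<close>
lemma yukawa_Z_1_eq: "hb * yukawa_Z $ 1 = fps_deriv (yukawa_Z $ 0) - fps_X * (hbi * yukawa_Z $ 0)"
proof (intro fps_ext fls_eqI)
  fix a n
  have L: "(hb * yukawa_Z $ 1) $ a $$ n = (if 2 * (n + int a) \<ge> int a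
     then of_int (2 * (n + int a) - int a + 1) * dfact_int (n + int a) / fact a else 0)"
    by (simp add: fls_X_times_conv_shift(1) yukawa_Z_nth_1[simplified] algebra_simps)
  have rec: "dfact_int (n + int a + 1) = (2 * real_of_int (n + int a) + 1) * dfact_int (n + int a)"
    by (rule dfact_int_rec)
  have 1: "fps_deriv (yukawa_Z $ 0) $ a $$ n = real (Suc a) * yukawa_Z $ 0 $ Suc a $$ n"
    by (simp del: of_nat_Suc)
  have 2: "real (Suc a) * yukawa_Z $ 0 $ Suc a $$ n =
      (if 2 * (n + int a) \<ge> int a - 1 then dfact_int (n + int a + 1) / fact a else 0)"
    unfolding yukawa_Z_nth_0 if_distrib[of "\<lambda>x. real (Suc a) * x"] Suc_mult_div_fact mult_zero_right
    by (rule if_cong) (auto simp: algebra_simps)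
  show "(hb * yukawa_Z $ 1) $ a $$ n = (fps_deriv (yukawa_Z $ 0) - fps_X * (hbi * yukawa_Z $ 0)) $ a $$ n"
  proof (cases a)
    case 0
    then show ?thesis
      unfolding L using 1 2 rec by (auto simp: 0)
  next
    case (Suc b)
    have 3: "(fps_X * (hbi * yukawa_Z $ 0)) $ a $$ n =
        (if 2 * (n + int a) \<ge> int a - 1 then real a * dfact_int (n + int a) / fact a else 0)"
    proof -
      have "(fps_X * (hbi * yukawa_Z $ 0)) $ a $$ n = yukawa_Z $ 0 $ b $$ (n + 1)"
        by (simp add: Suc fls_X_inv_times_conv_shift(1))
      also have "\<dots> = (if 2 * (n + int a) \<ge> int a - 1 then dfact_int (n + int a) / fact b else 0)"
        unfolding yukawa_Z_nth_0 by (rule if_cong) (auto simp: Suc algebra_simps)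
      finally show ?thesis
        unfolding Suc times_divide_eq_right[symmetric] Suc_mult_div_fact .
    qed
    have R: "(fps_deriv (yukawa_Z $ 0) - fps_X * (hbi * yukawa_Z $ 0)) $ a $$ n =
        (if 2 * (n + int a) \<ge> int a - 1 then of_int (2 * (n + int a) - int a + 1) * dfact_int (n + int a) / fact a else 0)"
      unfolding fps_sub_nth fls_minus_nth 1 2 3 rec by (simp add: field_simps)
    show ?thesis
    \<comment> \<open>The two ranges differ only at this index, where the factor
      \<open>2 * (n + a) - a + 1\<close> is zero.\<close>
    proof (cases "2 * (n + int a) = int a - 1")
      case True
      then have "2 * (n + int a) - int a + 1 = 0" by simp
      then show ?thesis unfolding L R by (simp only: of_int_0 mult_zero_left div_0 if_cancel)
    qed (use L R in auto)
  qed
qed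

section \<open>The closed form of the partition function\<close>

definition gaussian :: "real fls fps" where
  "gaussian = fsub (fps_exp 1) (rconst (1 / 2) * fps_X ^ 2 * hbi)"
definition geo :: "real fls fps" where "geo = inverse (1 - fps_X)"
definition harg :: "real fls fps" where "harg = hb * geo ^ 2"
definition chi_sub :: "real fls fps" where "chi_sub = fsub chi harg"
definition chi_sub' :: "real fls fps" where "chi_sub' = fsub (fps_deriv chi) harg"

lemma hval_gaussian_arg: "hval 1 (rconst (1 / 2) * fps_X ^ 2 * hbi)"
proof -
  have "hval (2 + 2 + - 1) (fps_X * fps_X * hbi)"
    by (intro hval_mult hval_X hval_hbi)
  then show ?thesis
    unfolding mult.assoc power2_eq_square by (intro hval_const_mult hval_mono[of 3 _ 1]) simp_all
qed

lemma geo_mult: "geo * (1 - fps_X) = 1"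
  unfolding geo_def by (rule inverse_mult_eq_1) simp

lemma geo_0: "geo $ 0 = 1"
  by (simp add: geo_def)

lemma hval_geo: "hval 0 geo"
  by (simp add: hval_def geo_def)

lemma hval_harg: "hval 1 harg"
  using hval_mult[OF hval_hb hval_mult[OF hval_geo hval_geo]] by (simp add: harg_def power2_eq_square)

lemma deriv_geo: "fps_deriv geo = geo ^ 2"
  unfolding geo_def by (subst fps_inverse_deriv) simp_all

lemma theta_geo: "theta geo = 0"
  by (rule fps_ext) (simp add: geo_def euler_deriv_def)

lemma deriv_harg: "fps_deriv harg = 2 * geo * harg"
  by (simp add: harg_def power2_eq_square deriv_geo)

lemma theta_harg: "theta harg = harg"
  by (simp add: harg_def power2_eq_square theta_mult theta_geo)

lemma deriv_chi_sub: "fps_deriv chi_sub = chi_sub' * (2 * geo * harg)"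
  unfolding chi_sub_def chi_sub'_def
  by (simp only: hderivation_fsub[OF hderivation_fps_deriv hval_harg] deriv_harg)

lemma theta_chi_sub: "theta chi_sub = chi_sub' * harg"
  unfolding chi_sub_def chi_sub'_def
  by (simp only: hderivation_fsub[OF hderivation_theta hval_harg] theta_harg)

lemma chi_sub_0: "chi_sub $ 0 = fps_to_fls chi"
  unfolding chi_sub_def by (rule fsub_nth_0_X) (simp add: harg_def geo_0 power2_eq_square)

lemma chi_sub_ode: "chi_sub = 1 + harg * chi_sub + 2 * harg ^ 2 * chi_sub'"
proof -
  have "chi = fps_const 1 + (fps_X * chi + fps_X * (fps_X * (fps_const 2 * fps_deriv chi)))"
    by (subst chi_ode) (simp add: power2_eq_square numeral_fps_const mult_ac)
  then have "chi_sub = fsub (fps_const 1 + (fps_X * chi + fps_X * (fps_X * (fps_const 2 * fps_deriv chi)))) harg"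
    unfolding chi_sub_def by (rule arg_cong)
  also have "\<dots> = rconst 1 + (harg * chi_sub + harg * (harg * (rconst 2 * chi_sub')))"
    by (simp only: fsub_add[OF hval_harg] fsub_X_mult[OF hval_harg] fsub_const[OF hval_harg]
        fsub_const_mult[OF hval_harg] chi_sub_def chi_sub'_def)
  also have "\<dots> = 1 + harg * chi_sub + 2 * harg ^ 2 * chi_sub'"
    by (simp add: power2_eq_square numeral_fps_const mult_ac)
  finally show ?thesis .
qed

lemma gaussian_0: "gaussian $ 0 = 1"
  by (simp add: gaussian_def fsub_nth_0)

lemma rconst_half: "2 * rconst (1 / 2) = 1"
proof -
  have "rconst 2 * rconst (1 / 2) = rconst (2 * (1 / 2))" by (rule rconst_mult[symmetric])
  also have "\<dots> = 1" by simp
  finally show ?thesis by (simp only: fls_const_numeral flip: numeral_fps_const)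
qed

lemma deriv_gaussian: "fps_deriv gaussian = fps_X * hbi * gaussian"
proof -
  have "fps_deriv (rconst (1 / 2) * fps_X ^ 2 * hbi) = (2 * rconst (1 / 2)) * fps_X * hbi"
    by (simp add: power2_eq_square algebra_simps)
  then have d: "fps_deriv (rconst (1 / 2) * fps_X ^ 2 * hbi) = fps_X * hbi"
    unfolding rconst_half by simp
  show ?thesis
    unfolding gaussian_def hderivation_fsub[OF hderivation_fps_deriv hval_gaussian_arg] d
    by (simp add: mult.commute)
qed

lemma theta_gaussian: "theta gaussian = - (rconst (1 / 2) * fps_X ^ 2 * hbi) * gaussian"
proof -
  have d: "theta (rconst (1 / 2) * fps_X ^ 2 * hbi) = - (rconst (1 / 2) * fps_X ^ 2 * hbi)"
    by (simp add: theta_mult power2_eq_square)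
  show ?thesis
    unfolding gaussian_def hderivation_fsub[OF hderivation_theta hval_gaussian_arg] d
    by (simp add: mult.commute)
qed

text \<open>Both sides solve F - \<hbar> F' = e^(j^2/(2\<hbar>)) with the value \<chi> at j =
  0.\<close>

lemma yukawa_Z_0: "yukawa_Z $ 0 = gaussian * geo * chi_sub"
proof -
  define Z where "Z = yukawa_Z $ 0"
  define Q where "Q = gaussian * geo * chi_sub"
  have "Z - hb * fps_deriv Z = gaussian"
  proof (rule fps_linear_ode_unique[OF _ deriv_gaussian])
    show "fps_deriv (Z - hb * fps_deriv Z) = fps_X * hbi * (Z - hb * fps_deriv Z)"
      unfolding Z_def by (rule yukawa_Z_0_ode)
    have "(Z - hb * fps_deriv Z) $ 0 $$ n = (1 :: real fls) $$ n" for n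
      by (simp add: Z_def fls_X_times_conv_shift(1) yukawa_Z_nth_0) (use dfact_int_nat[of 0] in simp)
    then show "(Z - hb * fps_deriv Z) $ 0 = gaussian $ 0"
      unfolding gaussian_0 by (rule fls_eqI)
  qed
  moreover have "Q - hb * fps_deriv Q = gaussian"
  proof -
    have Q': "fps_deriv Q = fps_X * hbi * Q + gaussian * geo ^ 2 * chi_sub + gaussian * geo * (chi_sub' * (2 * geo * harg))"
      by (simp add: Q_def deriv_gaussian deriv_geo deriv_chi_sub algebra_simps)
    \<comment> \<open>The derivative of the Gaussian supplies j Q, which completes
      \<open>geo\<close> to \<open>geo * (1 - fps_X) = 1\<close>; the remaining bracket is the
      differential equation of \<chi>.\<close>
    have "Q - hb * fps_deriv Q = gaussian * (geo * (1 - fps_X) * chi_sub) -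
        gaussian * (harg * chi_sub + 2 * harg ^ 2 * chi_sub')"
      unfolding Q' using hb_mult_hbi unfolding Q_def harg_def by algebra
    also have "\<dots> = gaussian * (chi_sub - harg * chi_sub - 2 * harg ^ 2 * chi_sub')"
      unfolding geo_mult by (simp add: algebra_simps)
    also have "chi_sub - harg * chi_sub - 2 * harg ^ 2 * chi_sub' = 1"
      using chi_sub_ode by algebra
    finally show ?thesis by simp
  qed
  \<comment> \<open>The difference solves the homogeneous equation and vanishes at j = 0.\<close>
  ultimately have "hb * (fps_deriv Z - fps_deriv Q) = Z - Q"
    unfolding right_diff_distrib by (metis diff_diff_eq2 diff_add_cancel add_diff_cancel_left')
  then have "hbi * (hb * (fps_deriv Z - fps_deriv Q)) = hbi * (Z - Q)"
    by (rule arg_cong)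
  then have "fps_deriv (Z - Q) = hbi * (Z - Q)"
    using hb_mult_hbi by (simp only: mult.assoc[symmetric] mult.commute[of hbi hb] mult_1 fps_deriv_sub)
  then have "Z - Q = 0"
    by (rule fps_linear_ode_unique)
      (simp_all add: Z_def Q_def yukawa_Z_0_0 gaussian_0 geo_0 chi_sub_0)
  then show ?thesis by (simp add: Z_def Q_def)
qed

lemma yukawa_Z_1: "yukawa_Z $ 1 = hbi * (gaussian * (geo ^ 2 * chi_sub + geo * (chi_sub' * (2 * geo * harg))))"
proof -
  have "fps_deriv (yukawa_Z $ 0) = fps_X * hbi * yukawa_Z $ 0 +
      gaussian * (geo ^ 2 * chi_sub + geo * (chi_sub' * (2 * geo * harg)))"
    by (simp add: yukawa_Z_0 deriv_gaussian deriv_geo deriv_chi_sub algebra_simps)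
  then show ?thesis
    using yukawa_Z_1_eq hb_mult_hbi by algebra
qed

section \<open>Orders 0 and 1 of the stated formula for Z\<close>

lemma yseries_simps:
  "(F * G) $ 0 = F $ 0 * (G :: yseries) $ 0"
  "(F * G) $ 1 = F $ 0 * G $ 1 + F $ 1 * G $ 0"
  "coef f $ 0 = fps_const f" "coef f $ 1 = 0"
  "hbar $ 0 = hb" "hbar $ 1 = 0" "inv_hbar $ 0 = hbi" "inv_hbar $ 1 = 0"
  "src $ 0 = fps_X" "src $ 1 = 0" "eta_sq $ 0 = 0" "eta_sq $ 1 = 1"
  "(1 :: yseries) $ 0 = 1" "(1 :: yseries) $ 1 = 0"
  "(F + G) $ i = F $ i + G $ i" "(F - G) $ i = F $ i - G $ i"
  "(F ^ 2) $ 0 = (F $ 0) ^ 2" "(F ^ 2) $ 1 = 2 * F $ 0 * F $ 1"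
  by (simp_all add: yseries_mult_nth_1 coef_def hbar_def inv_hbar_def src_def eta_sq_def
      power2_eq_square)

lemma yexp_nth:
  assumes "hval 1 (u $ 0)" "u $ 1 = 0"
  shows "yexp u $ 0 = fsub (fps_exp 1) (u $ 0)" "yexp u $ 1 = 0"
  using subst_nth_1[OF assms(1), of 0] assms(2) by (simp_all add: yexp_def subst_nth_0)

definition shift_factor :: yseries where "shift_factor = 1 - src - eta_sq * inv_hbar"
definition chi_series :: yseries where "chi_series = subst chi (hbar * inverse (shift_factor ^ 2))"

lemma shift_factor_nth: "shift_factor $ 0 = 1 - fps_X" "shift_factor $ 1 = - hbi"
  by (simp_all only: shift_factor_def yseries_simps) simp_all

lemma inverse_shift_factor_nth:
  "inverse shift_factor $ 0 = geo" "inverse shift_factor $ 1 = hbi * geo ^ 2"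
proof -
  have "shift_factor $ 0 $ 0 \<noteq> 0" unfolding shift_factor_nth by simp
  note inv = yseries_inverse_nth[OF this]
  show "inverse shift_factor $ 0 = geo" "inverse shift_factor $ 1 = hbi * geo ^ 2"
    unfolding inv shift_factor_nth geo_def by simp_all
qed

lemma inverse_one_minus_X_square: "inverse ((1 - fps_X) ^ 2) = geo ^ 2"
  unfolding geo_def by (rule fps_inverse_power)

lemma chi_series_nth:
  "chi_series $ 0 = chi_sub" "chi_series $ 1 = chi_sub' * (2 * geo ^ 3)"
proof -
  let ?u = "hbar * inverse (shift_factor ^ 2)"
  have sq: "(shift_factor ^ 2) $ 0 = (1 - fps_X) ^ 2" "(shift_factor ^ 2) $ 1 = - (2 * (1 - fps_X) * hbi)"
    by (simp_all only: yseries_simps shift_factor_nth) simp_all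
  have "(shift_factor ^ 2) $ 0 $ 0 \<noteq> 0"
    unfolding sq by (simp add: power2_eq_square)
  note inv = yseries_inverse_nth[OF this, unfolded sq inverse_one_minus_X_square]
  have u0: "?u $ 0 = harg"
    by (simp only: yseries_simps inv harg_def)
  \<comment> \<open>The \<hbar> in the numerator cancels the 1/\<hbar> that accompanies
    |\<eta>|^2.\<close>
  have "?u $ 1 = hb * (2 * (1 - fps_X) * hbi * (geo ^ 2) ^ 2)"
    by (simp only: yseries_simps inv) simp
  also have "\<dots> = 2 * geo ^ 3"
    using hb_mult_hbi geo_mult by algebra
  finally have u1: "?u $ 1 = 2 * geo ^ 3" .
  have "hval (0 + (0 + 0)) (geo * (geo * geo))"
    by (intro hval_mult hval_geo)
  then have "hval 0 (geo ^ 3)"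
    unfolding power3_eq_cube mult.assoc by simp
  then have "hval 0 (?u $ 1)"
    unfolding u1 mult_2 by (intro hval_add)
  with hval_harg u0 show "chi_series $ 0 = chi_sub" "chi_series $ 1 = chi_sub' * (2 * geo ^ 3)"
    using subst_nth_1[of ?u 0 chi] unfolding chi_series_def subst_nth_0 u0 u1 chi_sub_def chi_sub'_def
    by simp_all
qed

lemma partition_function_eq:
  "eq_mod_eta4 yukawa_Z (yexp (coef (fls_const (1 / 2)) * src ^ 2 * inv_hbar) * inverse shift_factor * chi_series)"
    (is "eq_mod_eta4 _ ?R")
proof -
  let ?u = "coef (fls_const (1 / 2)) * src ^ 2 * inv_hbar"
  have u: "?u $ 0 = rconst (1 / 2) * fps_X ^ 2 * hbi" "?u $ 1 = 0"
    by (simp_all only: yseries_simps) simp_all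
  have e: "yexp ?u $ 0 = gaussian" "yexp ?u $ 1 = 0"
    using yexp_nth[of ?u] hval_gaussian_arg unfolding u gaussian_def by simp_all
  have "?R $ 0 = yukawa_Z $ 0"
    by (simp only: yseries_simps e inverse_shift_factor_nth chi_series_nth yukawa_Z_0)
  moreover have "?R $ 1 = gaussian * geo * (chi_sub' * (2 * geo ^ 3)) + gaussian * (hbi * geo ^ 2) * chi_sub"
    by (simp only: yseries_simps e inverse_shift_factor_nth chi_series_nth) simp
  moreover have "\<dots> = yukawa_Z $ 1"
    unfolding yukawa_Z_1 harg_def using hb_mult_hbi by algebra
  ultimately show ?thesis
    unfolding eq_mod_eta4_def by (metis One_nat_def less_2_cases)
qed

section \<open>Asymptotics of the partition function\<close>

text \<open>By uniqueness of the expansion it is enough to exhibit one in the scale of double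
  factorials.\<close>

lemma asymp_eq_mod_eta4I:
  assumes "\<And>b a. b < 2 \<Longrightarrow> asy (F $ b $ a) (T b $ a)"
    and "\<And>b. b < 2 \<Longrightarrow> G $ b = rconst (1 / sqrt (2 * pi)) * T b"
  shows "asymp_eq_mod_eta4 (1 / 2) F (- (1 / 2)) G"
  unfolding asymp_eq_mod_eta4_def
proof (intro allI impI conjI)
  fix b a :: nat assume b: "b < 2"
  note asy = assms(1)[OF b, of a]
  show "factorially_expandable (1 / 2) (F $ b $ a)"
    using asy by (rule asy_expandable)
  show "asymp_op (1 / 2) (F $ b $ a) = hbar_powr (- (1 / 2)) (G $ b $ a)"
    unfolding asymp_op_eqI[OF asy_has_factorial_expansion[OF asy]] hbar_powr_subdegree assms(2)[OF b]
    by simp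
qed

lemma asy_chi: "asy (fps_to_fls chi) 1"
proof -
  have lower: "\<forall>k<0. (1 :: real fls) $$ k = 0" by simp
  show ?thesis
    unfolding asy_iff[OF lower]
  proof
    fix N :: int
    have "asy_error (fps_to_fls chi) 1 0 N = (\<lambda>n. if N > 0 then 0 else dfact_int (int n))"
    proof
      fix n
      have "(\<Sum>k\<in>{0..<N}. (1 :: real fls) $$ k * dfact_int (int n - k)) =
          (\<Sum>k\<in>{0..<N}. if k = 0 then dfact_int (int n) else 0)"
        by (rule sum.cong) auto
      then show "asy_error (fps_to_fls chi) 1 0 N n = (if N > 0 then 0 else dfact_int (int n))"
        by (simp add: asy_error_def dfact_int_of_nat)
    qed
    then show "asy_error (fps_to_fls chi) 1 0 N \<in> O(\<lambda>n. dfact_int (int n - N))"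
      using dfact_int_bigo_mono[of N 0] by (cases "N > 0") simp_all
  qed
qed

definition exp_src :: "real fls fps" where "exp_src = fsub (fps_exp 1) (fps_X * hbi)"

lemma hval_X_hbi: "hval 1 (fps_X * hbi)"
  using hval_mult[OF hval_X hval_hbi] by simp

lemma deriv_exp_src: "fps_deriv exp_src = hbi * exp_src"
  unfolding exp_src_def hderivation_fsub[OF hderivation_fps_deriv hval_X_hbi]
  by (simp add: mult.commute)

lemma exp_src_nth: "exp_src $ a = fls_const (1 / fact a) * fls_shift (int a) 1"
proof (induction a)
  case 0
  show ?case by (simp add: exp_src_def fsub_nth_0)
next
  case (Suc a)
  have "of_nat (Suc a) * exp_src $ Suc a = fls_X_inv * exp_src $ a"
    using arg_cong[OF deriv_exp_src, of "\<lambda>F. F $ a"] by simp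
  also have "\<dots> = of_nat (Suc a) * (fls_const (1 / fact (Suc a)) * fls_shift (int (Suc a)) 1)"
    unfolding Suc
    by (rule fls_eqI, simp only: fls_mult_of_nat_nth fls_mult_const_nth fls_X_inv_times_conv_shift(1)
        fls_shift_nth times_divide_eq_left mult_1 Suc_mult_div_fact) (simp add: add_ac)
  finally show ?case by (metis mult_cancel_left of_nat_eq_0_iff nat.distinct(1))
qed

text \<open>For nonnegative powers of \<hbar> the coefficient of j^a is that of \<chi> shifted by
  \<open>a\<close> and divided by a!. The operator sends \<chi> to a constant times \<hbar>^(-1/2),
  which leaves the coefficients of e^(j/\<hbar>).\<close>

lemma asy_yukawa_Z_0: "asy (yukawa_Z $ 0 $ a) (exp_src $ a)"
proof (rule asy_cong)
  show "asy (fls_const (1 / fact a) * fls_shift (int a) (fps_to_fls chi)) (exp_src $ a)"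
    unfolding exp_src_nth by (intro asy_scale asy_shift asy_chi)
  show "\<forall>\<^sub>F n in at_top. (fls_const (1 / fact a) * fls_shift (int a) (fps_to_fls chi)) $$ int n = yukawa_Z $ 0 $ a $$ int n"
    by (rule always_eventually) (simp add: yukawa_Z_nth_0 dfact_int_nat[symmetric])
qed

lemma asy_fps_deriv: "(\<And>a. asy (F $ a) (G $ a)) \<Longrightarrow> asy (fps_deriv F $ a) (fps_deriv G $ a)"
  by (simp add: asy_of_nat_mult del: of_nat_Suc)

lemma asy_0: "asy 0 0"
  using asy_diff[OF asy_chi asy_chi] by simp

lemma asy_fps_X_mult: "(\<And>a. asy (F $ a) (G $ a)) \<Longrightarrow> asy ((fps_X * F) $ a) ((fps_X * G) $ a)"
  by (simp add: asy_0)

text \<open>Integration by parts expresses order 1 through order 0 by operations that commute with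
  the expansion: d/dj and multiplication by j and 1/\<hbar>.\<close>

lemma asy_yukawa_Z_1: "asy (yukawa_Z $ 1 $ a) ((exp_src * (1 - fps_X) * hbi ^ 2) $ a)"
proof -
  let ?S = "\<lambda>F. hbi * (fps_deriv F - fps_X * (hbi * F))"
  have "asy (?S (yukawa_Z $ 0) $ a) (?S exp_src $ a)"
    unfolding fps_mult_left_const_nth fps_sub_nth
    by (intro asy_X_inv_mult asy_diff asy_fps_deriv asy_fps_X_mult asy_yukawa_Z_0)
      (simp add: asy_X_inv_mult asy_yukawa_Z_0)
  moreover have "?S (yukawa_Z $ 0) = yukawa_Z $ 1"
    using yukawa_Z_1_eq hb_mult_hbi by algebra
  moreover have "?S exp_src = exp_src * (1 - fps_X) * hbi ^ 2"
    unfolding deriv_exp_src by algebra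
  ultimately show ?thesis by simp
qed

lemma partition_function_asymptotics:
  "asymp_eq_mod_eta4 (1 / 2) yukawa_Z (- (1 / 2))
     (coef (fls_const (1 / sqrt (2 * pi))) * yexp (src * inv_hbar) * (1 + eta_sq * (1 - src) * inv_hbar ^ 2))"
proof (rule asymp_eq_mod_eta4I)
  let ?T = "\<lambda>b. if b = 0 then exp_src else exp_src * (1 - fps_X) * hbi ^ 2"
  show "asy (yukawa_Z $ b $ a) (?T b $ a)" if "b < 2" for b a
    using that asy_yukawa_Z_0[of a] asy_yukawa_Z_1[of a] by (auto dest!: less_2_cases)
  let ?u = "src * inv_hbar"
  have u: "?u $ 0 = fps_X * hbi" "?u $ 1 = 0"
    by (simp_all only: yseries_simps) simp_all
  have e: "yexp ?u $ 0 = exp_src" "yexp ?u $ 1 = 0"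
    using yexp_nth[of ?u] hval_X_hbi unfolding u exp_src_def by simp_all
  let ?G = "coef (fls_const (1 / sqrt (2 * pi))) * yexp (src * inv_hbar) * (1 + eta_sq * (1 - src) * inv_hbar ^ 2)"
  have "?G $ 0 = rconst (1 / sqrt (2 * pi)) * exp_src"
    by (simp only: yseries_simps e) simp
  moreover have "?G $ 1 = rconst (1 / sqrt (2 * pi)) * (exp_src * (1 - fps_X) * hbi ^ 2)"
    by (simp only: yseries_simps e) (simp add: mult.assoc)
  ultimately show "?G $ b = rconst (1 / sqrt (2 * pi)) * ?T b" if "b < 2" for b
    using that by (auto dest!: less_2_cases)
qed

section \<open>Asymptotics of the free energy\<close>

definition log_Z :: "real fls fps" where "log_Z = fsub (fps_ln 1) (yukawa_Z $ 0 - 1)"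

text \<open>Convergence of the logarithm: the coefficient of j^a contains only powers \<hbar>^n with
  \<open>n \<ge> - a / 2\<close>, and the constant term 1 is removed.\<close>

lemma hval_yukawa_Z_0: "hval 1 (yukawa_Z $ 0 - 1)"
  unfolding hval_def
proof (intro allI impI)
  fix i k assume k: "k < 1 - 2 * int i"
  show "(yukawa_Z $ 0 - 1) $ i $$ k = 0"
  proof (cases i)
    case 0
    then show ?thesis using k dfact_int_nat[of 0] by (cases "k = 0") (auto simp: 0 yukawa_Z_nth_0)
  qed (use k in \<open>auto simp: yukawa_Z_nth_0\<close>)
qed

lemma hval_yukawa_Z_1: "hval (-1) (yukawa_Z $ 1)"
  unfolding hval_def yukawa_Z_nth_1 by auto

lemma yukawa_Z_0_inverse: "inverse (yukawa_Z $ 0) * yukawa_Z $ 0 = 1"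
  by (rule inverse_mult_eq_1) (auto simp: yukawa_Z_0_0 fps_eq_iff intro!: exI[of _ 0])

lemma fsub_ln_deriv: "fsub (fps_deriv (fps_ln 1)) (yukawa_Z $ 0 - 1) = inverse (yukawa_Z $ 0)"
  using fsub_geometric[OF hval_yukawa_Z_0] by (simp add: fps_ln_deriv)

lemma yukawa_W_nth:
  "yukawa_W $ 0 = hb * log_Z" "yukawa_W $ 1 = hb * (inverse (yukawa_Z $ 0) * yukawa_Z $ 1)"
proof -
  have "(yukawa_Z - 1) $ 0 = yukawa_Z $ 0 - 1" "(yukawa_Z - 1) $ 1 = yukawa_Z $ 1"
    by simp_all
  then have "ylog yukawa_Z $ 0 = log_Z" "ylog yukawa_Z $ 1 = inverse (yukawa_Z $ 0) * yukawa_Z $ 1"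
    using subst_nth_1[of "yukawa_Z - 1" "- 1" "fps_ln 1"] hval_yukawa_Z_0 hval_yukawa_Z_1 fsub_ln_deriv
    unfolding ylog_def log_Z_def subst_nth_0 by simp_all
  then show "yukawa_W $ 0 = hb * log_Z" "yukawa_W $ 1 = hb * (inverse (yukawa_Z $ 0) * yukawa_Z $ 1)"
    unfolding yukawa_W_def yseries_simps by simp_all
qed

lemma log_Z_derivs:
  "fps_deriv log_Z = inverse (yukawa_Z $ 0) * fps_deriv (yukawa_Z $ 0)"
  "theta log_Z = inverse (yukawa_Z $ 0) * theta (yukawa_Z $ 0)"
proof -
  have "theta 1 = 0"
    using theta_rconst[of 1] by simp
  then show "fps_deriv log_Z = inverse (yukawa_Z $ 0) * fps_deriv (yukawa_Z $ 0)"
    "theta log_Z = inverse (yukawa_Z $ 0) * theta (yukawa_Z $ 0)"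
    unfolding log_Z_def hderivation_fsub[OF hderivation_fps_deriv hval_yukawa_Z_0]
      hderivation_fsub[OF hderivation_theta hval_yukawa_Z_0] fsub_ln_deriv
    by (simp_all add: theta_diff)
qed

lemma yukawa_W_1: "yukawa_W $ 1 = fps_deriv log_Z - fps_X * hbi"
proof -
  have "yukawa_W $ 1 = inverse (yukawa_Z $ 0) * (hb * yukawa_Z $ 1)"
    unfolding yukawa_W_nth by (simp only: mult_ac)
  also have "\<dots> = fps_deriv log_Z - (inverse (yukawa_Z $ 0) * yukawa_Z $ 0) * (fps_X * hbi)"
    unfolding yukawa_Z_1_eq log_Z_derivs by (simp add: algebra_simps)
  finally show ?thesis unfolding yukawa_Z_0_inverse by simp
qed

definition inv_chi_sub :: "real fls fps" where "inv_chi_sub = inverse chi_sub"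

lemma inv_chi_sub_mult: "inv_chi_sub * chi_sub = 1"
  unfolding inv_chi_sub_def
  by (rule inverse_mult_eq_1) (auto simp: chi_sub_0 fps_eq_iff intro!: exI[of _ 0])

lemma inv_chi_sub_0: "inv_chi_sub $ 0 = fps_to_fls (inverse chi)"
  by (simp add: inv_chi_sub_def chi_sub_0 fls_inverse_fps_to_fls)

lemma deriv_chi_sub_theta: "(1 - fps_X) * fps_deriv chi_sub = 2 * theta chi_sub"
  unfolding deriv_chi_sub theta_chi_sub using geo_mult by algebra

lemma inv_chi_sub_derivs:
  "fps_deriv inv_chi_sub = - (fps_deriv chi_sub * inv_chi_sub ^ 2)"
  "theta inv_chi_sub = - (theta chi_sub * inv_chi_sub ^ 2)"
proof -
  have "chi_sub $ 0 \<noteq> 0"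
    by (auto simp: chi_sub_0 fps_eq_iff intro!: exI[of _ 0])
  then show "fps_deriv inv_chi_sub = - (fps_deriv chi_sub * inv_chi_sub ^ 2)"
    unfolding inv_chi_sub_def by (subst fps_inverse_deriv) simp_all
  have "theta 1 = 0"
    using theta_rconst[of 1] by simp
  then have "inv_chi_sub * theta chi_sub + theta inv_chi_sub * chi_sub = 0"
    using theta_mult[of inv_chi_sub chi_sub] unfolding inv_chi_sub_mult by simp
  then show "theta inv_chi_sub = - (theta chi_sub * inv_chi_sub ^ 2)"
    using inv_chi_sub_mult by algebra
qed

text \<open>
  \<open>log Z\<close> is \<open>j\<^sup>2 / (2 \<hbar>) + log (1 / (1 - j))\<close> plus a function of \<open>\<hbar> / (1 - j)\<^sup>2\<close>, on which
  \<open>(1 - j) \<partial>/\<partial>j\<close> and \<open>2 \<hbar> \<partial>/\<partial>\<hbar>\<close> agree.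
\<close>
lemma log_Z_ode: "(1 - fps_X) * fps_deriv log_Z = 1 + fps_X * hbi + 2 * theta log_Z"
proof -
  define Z where "Z = yukawa_Z $ 0"
  define h where "h = rconst (1 / 2)"
  define T where "T = theta chi_sub"
  define S where "S = fps_deriv chi_sub"
  have h: "2 * h = 1" unfolding h_def by (rule rconst_half)
  have Z: "Z = gaussian * geo * chi_sub" by (simp add: Z_def yukawa_Z_0)
  have Z': "fps_deriv Z = fps_X * hbi * Z + geo * Z + gaussian * geo * S"
    by (simp add: Z deriv_gaussian deriv_geo S_def algebra_simps power2_eq_square)
  have tZ: "theta Z = - (h * fps_X ^ 2 * hbi) * Z + gaussian * geo * T"
    unfolding Z theta_mult theta_gaussian theta_geo T_def h_def by (simp add: algebra_simps)
  have S: "(1 - fps_X) * S = 2 * T" unfolding S_def T_def by (rule deriv_chi_sub_theta)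
  have "(1 - fps_X) * fps_deriv Z = Z + fps_X * hbi * Z + 2 * theta Z"
    unfolding Z' tZ using S h geo_mult by algebra
  then have "inverse Z * ((1 - fps_X) * fps_deriv Z) = inverse Z * (Z + fps_X * hbi * Z + 2 * theta Z)"
    by (rule arg_cong)
  then show ?thesis
    using yukawa_Z_0_inverse log_Z_derivs unfolding Z_def by algebra
qed

text \<open>This is e^(j/\<hbar>) divided by the order 0 part of Z, as \<A> log Z = \<A>Z / Z
  suggests.\<close>

definition log_Z_asy :: "real fls fps" where
  "log_Z_asy = fsub (fps_exp 1) (hbi * (fps_X - rconst (1 / 2) * fps_X ^ 2)) * (1 - fps_X) * inv_chi_sub"

lemma hval_free_energy_arg: "hval 1 (hbi * (fps_X - rconst (1 / 2) * fps_X ^ 2))"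
proof -
  have "hval (- 1 + 2) (hbi * (fps_X - rconst (1 / 2) * fps_X ^ 2))"
    using hval_mono[OF hval_mult[OF hval_X hval_X], of 2]
    by (intro hval_mult hval_hbi hval_diff hval_X hval_const_mult) (simp add: power2_eq_square)
  then show ?thesis by simp
qed

lemma log_Z_asy_deriv:
  "fps_deriv log_Z_asy = fsub (fps_exp 1) (hbi * (fps_X - rconst (1 / 2) * fps_X ^ 2)) *
    (hbi * (1 - fps_X) ^ 2 * inv_chi_sub - inv_chi_sub - (1 - fps_X) * fps_deriv chi_sub * inv_chi_sub ^ 2)"
  "theta log_Z_asy = fsub (fps_exp 1) (hbi * (fps_X - rconst (1 / 2) * fps_X ^ 2)) * (1 - fps_X) *
    (- hbi * (fps_X - rconst (1 / 2) * fps_X ^ 2) * inv_chi_sub - theta chi_sub * inv_chi_sub ^ 2)"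
proof -
  let ?u = "hbi * (fps_X - rconst (1 / 2) * fps_X ^ 2)"
  let ?E = "fsub (fps_exp 1) ?u"
  have "fps_deriv ?u = hbi * (1 - (2 * rconst (1 / 2)) * fps_X)"
    by (simp add: power2_eq_square algebra_simps)
  then have du: "fps_deriv ?u = hbi * (1 - fps_X)"
    unfolding rconst_half by simp
  have tu: "theta ?u = - ?u"
    by (simp add: theta_mult theta_diff power2_eq_square)
  have dE: "fps_deriv ?E = ?E * (hbi * (1 - fps_X))"
    unfolding hderivation_fsub[OF hderivation_fps_deriv hval_free_energy_arg] du by simp
  have tE: "theta ?E = ?E * - ?u"
    unfolding hderivation_fsub[OF hderivation_theta hval_free_energy_arg] tu by simp
  have d1: "fps_deriv (1 - fps_X :: real fls fps) = - 1"
    by simp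
  show "fps_deriv log_Z_asy = ?E * (hbi * (1 - fps_X) ^ 2 * inv_chi_sub - inv_chi_sub -
      (1 - fps_X) * fps_deriv chi_sub * inv_chi_sub ^ 2)"
    unfolding log_Z_asy_def fps_deriv_mult dE d1 inv_chi_sub_derivs by algebra
  show "theta log_Z_asy = ?E * (1 - fps_X) *
      (- hbi * (fps_X - rconst (1 / 2) * fps_X ^ 2) * inv_chi_sub - theta chi_sub * inv_chi_sub ^ 2)"
    unfolding log_Z_asy_def theta_mult tE theta_one_minus_X inv_chi_sub_derivs by algebra
qed

text \<open>The image of \<open>log_Z_ode\<close> under the expansion: \<theta> becomes \<theta> -
  1/2 + 1/(2\<hbar>), and the explicit terms disappear.\<close>

lemma log_Z_asy_ode: "(1 - fps_X) * fps_deriv log_Z_asy = 2 * theta log_Z_asy - log_Z_asy + hbi * log_Z_asy"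
proof -
  define h where "h = rconst (1 / 2)"
  define T where "T = theta chi_sub"
  define S where "S = fps_deriv chi_sub"
  have h: "2 * h = 1" unfolding h_def by (rule rconst_half)
  have S: "(1 - fps_X) * S = 2 * T" unfolding S_def T_def by (rule deriv_chi_sub_theta)
  show ?thesis
    unfolding log_Z_asy_deriv unfolding log_Z_asy_def h_def[symmetric] T_def[symmetric] S_def[symmetric]
    using S h by algebra
qed

lemma log_Z_asy_0: "log_Z_asy $ 0 = fps_to_fls (inverse chi)"
  by (simp add: log_Z_asy_def inv_chi_sub_0 fsub_nth_0)

text \<open>At j = 0, \<theta> log Z is \<hbar> \<chi>'/\<chi>, and dividing the equation of \<chi>
  by \<chi> gives 2 \<hbar>^2 \<chi>'/\<chi> = 1 - 1/\<chi> - \<hbar>, hence the shift from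
  \<open>n\<close> to \<open>Suc n\<close>.\<close>

lemma asy_log_Z_nth_0: "asy (log_Z $ 0) (log_Z_asy $ 0)"
  unfolding log_Z_asy_0
proof (rule asy_log_chi)
  fix n :: nat assume n: "n > 0"
  have "theta log_Z $ 0 = fps_to_fls (inverse chi * (fps_X * fps_deriv chi))"
    by (simp add: log_Z_derivs yukawa_Z_0_0 euler_deriv_def fls_deriv_fps_to_fls fls_inverse_fps_to_fls
        fls_times_fps_to_fls)
  then have "theta log_Z $ 0 $$ int n = (inverse chi * (fps_X * fps_deriv chi)) $ n"
    by (simp only: fps_to_fls_nth) simp
  then have "real n * log_Z $ 0 $$ int n = (inverse chi * (fps_X * fps_deriv chi)) $ n"
    by simp
  moreover have "2 * (inverse chi * (fps_X * fps_deriv chi)) $ n = indec (Suc n)"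
  proof -
    have "fps_X * (2 * (inverse chi * (fps_X * fps_deriv chi))) = 1 - inverse chi - fps_X"
      using chi_ode inverse_chi_mult by algebra
    then have "(fps_X * (2 * (inverse chi * (fps_X * fps_deriv chi)))) $ Suc n = indec (Suc n)"
      using n by (simp add: inverse_chi_nth)
    then show ?thesis by (simp add: numeral_fps_const)
  qed
  ultimately show "2 * real n * log_Z $ 0 $$ int n = indec (Suc n)"
    by simp
qed

lemma one_minus_X_mult_deriv_nth:
  "((1 - fps_X) * fps_deriv F) $ a = of_nat (Suc a) * F $ Suc a - of_nat a * (F $ a :: real fls)"
  by (cases a) (simp_all add: left_diff_distrib del: of_nat_Suc)

text \<open>The two differential equations give the coefficient of j^(a+1) from that of j^a in the
  same way, so the expansion propagates from j = 0.\<close>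

lemma asy_log_Z: "asy (log_Z $ a) (log_Z_asy $ a)"
proof (induction a)
  case (Suc a)
  let ?f = "\<lambda>a. log_Z $ a" and ?g = "\<lambda>a. log_Z_asy $ a"
  have half: "fls_const 2 * (fls_const (1 / 2) * f) = f" for f :: "real fls"
    by (rule fls_eqI) simp
  have "asy (of_nat a * ?f a + fls_const 2 * euler_deriv (?f a))
      (of_nat a * ?g a + fls_const 2 * (euler_deriv (?g a) - fls_const (1 / 2) * ?g a + fls_const (1 / 2) * (fls_X_inv * ?g a)))"
    by (intro asy_add asy_of_nat_mult asy_scale asy_euler_deriv Suc)
  also have "of_nat a * ?g a + fls_const 2 * (euler_deriv (?g a) - fls_const (1 / 2) * ?g a + fls_const (1 / 2) * (fls_X_inv * ?g a)) =
      of_nat (Suc a) * ?g (Suc a)"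
  proof -
    have "of_nat (Suc a) * ?g (Suc a) - of_nat a * ?g a = 2 * euler_deriv (?g a) - ?g a + fls_X_inv * ?g a"
      using arg_cong[OF log_Z_asy_ode, of "\<lambda>F. F $ a"]
      unfolding one_minus_X_mult_deriv_nth by (simp add: numeral_fps_const)
    then show ?thesis
      unfolding right_diff_distrib distrib_left[of "fls_const 2"] half by (simp add: algebra_simps)
  qed
  finally have "asy (of_nat (Suc a) * ?f (Suc a)) (of_nat (Suc a) * ?g (Suc a))"
  \<comment> \<open>Only coefficients with \<open>n > 0\<close> matter, so the terms 1 and j/\<hbar>
    of \<open>log_Z_ode\<close> drop out.\<close>
  proof (rule asy_cong)
    have "of_nat (Suc a) * ?f (Suc a) - of_nat a * ?f a =
        (if a = 0 then 1 else 0) + (if a = 1 then fls_X_inv else 0) + 2 * euler_deriv (?f a)"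
      using arg_cong[OF log_Z_ode, of "\<lambda>F. F $ a"]
      unfolding one_minus_X_mult_deriv_nth by (auto simp: numeral_fps_const)
    then have eq: "of_nat (Suc a) * ?f (Suc a) = of_nat a * ?f a +
        (if a = 0 then 1 else 0) + (if a = 1 then fls_X_inv else 0) + 2 * euler_deriv (?f a)"
      by (simp add: algebra_simps)
    show "\<forall>\<^sub>F n in at_top. (of_nat a * ?f a + fls_const 2 * euler_deriv (?f a)) $$ int n =
        (of_nat (Suc a) * ?f (Suc a)) $$ int n"
      using eventually_gt_at_top[of 0] unfolding eq by eventually_elim auto
  qed
  then have "asy (fls_const (1 / real (Suc a)) * (of_nat (Suc a) * ?f (Suc a)))
      (fls_const (1 / real (Suc a)) * (of_nat (Suc a) * ?g (Suc a)))"
    by (rule asy_scale)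
  moreover have "fls_const (1 / real (Suc a)) * (of_nat (Suc a) * f) = f" for f :: "real fls"
    by (rule fls_eqI) (simp del: of_nat_Suc)
  ultimately show ?case by (simp only:)
qed (rule asy_log_Z_nth_0)

lemma asy_yukawa_W:
  assumes "b < 2"
  shows "asy (yukawa_W $ b $ a) ((if b = 0 then hb * log_Z_asy else fps_deriv log_Z_asy) $ a)"
proof -
  have "asy (yukawa_W $ 0 $ a) ((hb * log_Z_asy) $ a)"
    unfolding yukawa_W_nth by (simp add: asy_X_mult asy_log_Z)
  moreover have "asy (yukawa_W $ 1 $ a) (fps_deriv log_Z_asy $ a)"
  proof (rule asy_cong)
    show "asy (fps_deriv log_Z $ a) (fps_deriv log_Z_asy $ a)"
      by (intro asy_fps_deriv asy_log_Z)
    show "\<forall>\<^sub>F n in at_top. fps_deriv log_Z $ a $$ int n = yukawa_W $ 1 $ a $$ int n"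
      unfolding yukawa_W_1 by (rule always_eventually) (simp del: of_nat_Suc)
  qed
  ultimately show ?thesis
    using assms by (auto dest!: less_2_cases)
qed

lemma free_energy_asymptotics:
  "asymp_eq_mod_eta4 (1 / 2) yukawa_W (- (1 / 2))
     (hbar * coef (fls_const (1 / sqrt (2 * pi))) *
      yexp (inv_hbar * (src - coef (fls_const (1 / 2)) * src ^ 2)) *
      (1 - src - eta_sq * inv_hbar * (1 - (1 - src) ^ 2 * inv_hbar)) *
      inverse chi_series)"
proof (rule asymp_eq_mod_eta4I[OF asy_yukawa_W])
  let ?u = "inv_hbar * (src - coef (fls_const (1 / 2)) * src ^ 2)"
  let ?c = "rconst (1 / sqrt (2 * pi))"
  let ?l = "1 - src - eta_sq * inv_hbar * (1 - (1 - src) ^ 2 * inv_hbar)"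
  let ?G = "hbar * coef (fls_const (1 / sqrt (2 * pi))) * yexp ?u * ?l * inverse chi_series"
  let ?E = "fsub (fps_exp 1) (hbi * (fps_X - rconst (1 / 2) * fps_X ^ 2))"
  have u: "?u $ 0 = hbi * (fps_X - rconst (1 / 2) * fps_X ^ 2)" "?u $ 1 = 0"
    by (simp_all only: yseries_simps) simp_all
  have e: "yexp ?u $ 0 = ?E" "yexp ?u $ 1 = 0"
    using yexp_nth[of ?u] hval_free_energy_arg unfolding u by simp_all
  have l: "?l $ 0 = 1 - fps_X" "?l $ 1 = - (hbi * (1 - (1 - fps_X) ^ 2 * hbi))"
    by (simp_all only: yseries_simps) simp_all
  have "chi_series $ 0 $ 0 \<noteq> 0"
    unfolding chi_series_nth by (auto simp: chi_sub_0 fps_eq_iff intro!: exI[of _ 0])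
  note inv = yseries_inverse_nth[OF this, unfolded chi_series_nth inv_chi_sub_def[symmetric]]
  have "?G $ 0 = ?c * (hb * log_Z_asy)"
  proof -
    have "?G $ 0 = hb * ?c * ?E * (1 - fps_X) * inv_chi_sub"
      by (simp only: yseries_simps e inv) simp
    then show ?thesis unfolding log_Z_asy_def by (simp only: mult_ac)
  qed
  \<comment> \<open>As for W itself, the order 1 part is the j-derivative of the order 0 part
    divided by \<hbar>.\<close>
  moreover have "?G $ 1 = ?c * fps_deriv log_Z_asy"
  proof -
    have "?G $ 1 = hb * ?c * ?E * (1 - fps_X) * (- (chi_sub' * (2 * geo ^ 3)) * inv_chi_sub ^ 2) +
        hb * ?c * ?E * - (hbi * (1 - (1 - fps_X) ^ 2 * hbi)) * inv_chi_sub"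
      by (simp only: yseries_simps e l inv) simp
    also have "\<dots> = ?c * fps_deriv log_Z_asy"
      unfolding log_Z_asy_deriv deriv_chi_sub harg_def using hb_mult_hbi by algebra
    finally show ?thesis .
  qed
  ultimately show "?G $ b = ?c * (if b = 0 then hb * log_Z_asy else fps_deriv log_Z_asy)" if "b < 2" for b
    using that by (auto dest!: less_2_cases)
qed

theorem mainTheorem14:
  shows "let s = 1 - src - eta_sq * inv_hbar;
             chi_s = subst chi (hbar * inverse (s ^ 2));
             inv_sqrt_2pi = coef (fls_const (1 / sqrt (2 * pi)))
         in
           eq_mod_eta4 yukawa_Z
             (yexp (coef (fls_const (1 / 2)) * src ^ 2 * inv_hbar) * inverse s * chi_s)
         \<and> asymp_eq_mod_eta4 (1 / 2) yukawa_Z (- (1 / 2))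
             (inv_sqrt_2pi * yexp (src * inv_hbar) * (1 + eta_sq * (1 - src) * inv_hbar ^ 2))
         \<and> asymp_eq_mod_eta4 (1 / 2) yukawa_W (- (1 / 2))
             (hbar * inv_sqrt_2pi *
              yexp (inv_hbar * (src - coef (fls_const (1 / 2)) * src ^ 2)) *
              (1 - src - eta_sq * inv_hbar * (1 - (1 - src) ^ 2 * inv_hbar)) *
              inverse chi_s)"
  using partition_function_eq partition_function_asymptotics free_energy_asymptotics
  unfolding Let_def chi_series_def shift_factor_def by blast

end
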